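(* Let $\mathcal O$ be an off-branch family in the ground model $V$, let $\mathbb B$ be the measure algebra on $2^\omega$ (so forcing with $\mathbb B$ adds a single random real), and let $G$ be $\mathbb B$-generic over $V$. Then in $V[G]$, $\mathcal O$ is not a maximal off-branch family.
   Context: Let ${}^{<\omega}\omega$ be the tree of finite sequences of natural numbers ordered by initial segment; a branch is a maximal linearly ordered set of nodes. Two infinite sets are almost disjoint if their intersection is finite. An infinite set of nodes is off-branch if it is almost disjoint from every branch; an off-branch family is a pairwise almost disjoint family of off-branch sets, maximal if no off-branch set is almost disjoint from all of its members. The measure algebra on $2^\omega$ is the Boolean algebra of Baire (Borel) subsets of $2^\omega$ modulo null sets for the product (coin-flipping) measure, with the zero element removed, used as a forcing notion. In $V[G]$, maximality is evaluated in $V[G]$. *)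

theory Defs
  imports "HOL-Probability.Probability" "HOL-Library.Sublist"
begin

section \<open>Off-branch families in the ground model\<close>

abbreviation branch :: "nat list set \<Rightarrow> bool" where
  "branch \<equiv> pred_on.maxchain UNIV strict_prefix"

definition off_branch :: "nat list set \<Rightarrow> bool" where
  "off_branch A \<longleftrightarrow> infinite A \<and> (\<forall>b. branch b \<longrightarrow> finite (A \<inter> b))"

definition off_branch_family :: "nat list set set \<Rightarrow> bool" where
  "off_branch_family F \<longleftrightarrow>
     (\<forall>A\<in>F. off_branch A) \<and> (\<forall>A\<in>F. \<forall>B\<in>F. A \<noteq> B \<longrightarrow> finite (A \<inter> B))"


section \<open>The measure algebra\<close>

text \<open>The measurable sets of this product are the sets generated by the clopen cylinders,
  i.e. the Baire (equivalently Borel) subsets of Cantor space.\<close>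

definition coin :: "(nat \<Rightarrow> bool) measure" where
  "coin = Pi\<^sub>M UNIV (\<lambda>_. measure_pmf (bernoulli_pmf (1/2)))"

lemma space_coin [simp]: "space coin = UNIV"
  by (auto simp: coin_def space_PiM)

lemma UNIV_coin [measurable, simp]: "UNIV \<in> sets coin"
  using sets.top[of coin] by simp

lemma prob_space_coin: "prob_space coin"
  unfolding coin_def by (intro prob_space_PiM measure_pmf.prob_space_axioms)

definition ae_eq :: "(nat \<Rightarrow> bool) set \<Rightarrow> (nat \<Rightarrow> bool) set \<Rightarrow> bool" where
  "ae_eq A B \<longleftrightarrow> A \<in> sets coin \<and> B \<in> sets coin \<and> (A - B) \<union> (B - A) \<in> null_sets coin"

lemma ae_eq_iff_AE:
  "ae_eq A B \<longleftrightarrow> A \<in> sets coin \<and> B \<in> sets coin \<and> (AE x in coin. x \<in> A \<longleftrightarrow> x \<in> B)"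
proof -
  have "((A - B) \<union> (B - A) \<in> null_sets coin) \<longleftrightarrow> (AE x in coin. x \<in> A \<longleftrightarrow> x \<in> B)"
    if "A \<in> sets coin" "B \<in> sets coin"
  proof -
    have "(A - B) \<union> (B - A) \<in> sets coin" using that by auto
    then have "((A - B) \<union> (B - A) \<in> null_sets coin) \<longleftrightarrow> (AE x in coin. x \<notin> (A - B) \<union> (B - A))"
      by (rule AE_iff_null_sets)
    also have "\<dots> \<longleftrightarrow> (AE x in coin. x \<in> A \<longleftrightarrow> x \<in> B)"
      by (rule AE_cong) auto
    finally show ?thesis .
  qed
  then show ?thesis by (auto simp: ae_eq_def)
qed

quotient_type measure_algebra = "(nat \<Rightarrow> bool) set" / partial: ae_eq
proof (rule part_equivpI)
  show "\<exists>A. ae_eq A A" by (rule exI[of _ "{}"]) (simp add: ae_eq_def)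
  show "symp ae_eq" by (auto simp: symp_def ae_eq_def Un_commute)
  show "transp ae_eq" unfolding transp_def ae_eq_iff_AE
    by (auto elim: eventually_elim2)
qed

lemma null_diff_iff_AE:
  assumes "A \<in> sets coin" "B \<in> sets coin"
  shows "A - B \<in> null_sets coin \<longleftrightarrow> (AE x in coin. x \<in> A \<longrightarrow> x \<in> B)"
proof -
  have "A - B \<in> sets coin" using assms by auto
  then have "A - B \<in> null_sets coin \<longleftrightarrow> (AE x in coin. x \<notin> A - B)"
    by (rule AE_iff_null_sets)
  also have "\<dots> \<longleftrightarrow> (AE x in coin. x \<in> A \<longrightarrow> x \<in> B)"
    by (rule AE_cong) auto
  finally show ?thesis .
qed

instantiation measure_algebra :: boolean_algebra
begin

lift_definition bot_measure_algebra :: measure_algebra is "{}"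
  by (simp add: ae_eq_def)

lift_definition top_measure_algebra :: measure_algebra is UNIV
  by (simp add: ae_eq_def)

lift_definition inf_measure_algebra ::
  "measure_algebra \<Rightarrow> measure_algebra \<Rightarrow> measure_algebra" is "(\<inter>)"
  unfolding ae_eq_iff_AE by (auto elim: eventually_elim2)

lift_definition sup_measure_algebra ::
  "measure_algebra \<Rightarrow> measure_algebra \<Rightarrow> measure_algebra" is "(\<union>)"
  unfolding ae_eq_iff_AE by (auto elim: eventually_elim2)

lift_definition minus_measure_algebra ::
  "measure_algebra \<Rightarrow> measure_algebra \<Rightarrow> measure_algebra" is "(-)"
  unfolding ae_eq_iff_AE by (auto elim: eventually_elim2)

lift_definition uminus_measure_algebra :: "measure_algebra \<Rightarrow> measure_algebra" is "uminus"
  unfolding ae_eq_iff_AE by (auto simp: Compl_eq_Diff_UNIV elim: eventually_mono)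

lift_definition less_eq_measure_algebra :: "measure_algebra \<Rightarrow> measure_algebra \<Rightarrow> bool"
  is "\<lambda>A B. A - B \<in> null_sets coin"
proof -
  fix A A' B B' assume *: "ae_eq A A'" "ae_eq B B'"
  then have AE: "AE x in coin. x \<in> A \<longleftrightarrow> x \<in> A'" "AE x in coin. x \<in> B \<longleftrightarrow> x \<in> B'"
    and s: "A \<in> sets coin" "A' \<in> sets coin" "B \<in> sets coin" "B' \<in> sets coin"
    by (auto simp: ae_eq_iff_AE)
  have "AE x in coin. (x \<in> A \<longrightarrow> x \<in> B) \<longleftrightarrow> (x \<in> A' \<longrightarrow> x \<in> B')"
    using AE by eventually_elim auto
  then have "(AE x in coin. x \<in> A \<longrightarrow> x \<in> B) \<longleftrightarrow> (AE x in coin. x \<in> A' \<longrightarrow> x \<in> B')"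
    by (rule eventually_subst)
  then show "(A - B \<in> null_sets coin) = (A' - B' \<in> null_sets coin)"
    using s by (simp add: null_diff_iff_AE)
qed

definition less_measure_algebra :: "measure_algebra \<Rightarrow> measure_algebra \<Rightarrow> bool" where
  "less_measure_algebra a b \<longleftrightarrow> a \<le> b \<and> \<not> b \<le> a"

instance
proof
  fix x y z :: measure_algebra
  show "(x < y) = (x \<le> y \<and> \<not> y \<le> x)" by (rule less_measure_algebra_def)
  show "x \<le> x" by transfer (simp add: ae_eq_def)
  show "x \<le> z" if "x \<le> y" "y \<le> z" using that
    by transfer (auto simp: ae_eq_iff_AE null_diff_iff_AE elim: eventually_elim2)
  show "x = y" if "x \<le> y" "y \<le> x" using that
    by transfer (auto simp: ae_eq_iff_AE null_diff_iff_AE elim: eventually_elim2)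
  show "inf x y \<le> x" by transfer (auto simp: ae_eq_iff_AE null_diff_iff_AE)
  show "inf x y \<le> y" by transfer (auto simp: ae_eq_iff_AE null_diff_iff_AE)
  show "x \<le> inf y z" if "x \<le> y" "x \<le> z" using that
    by transfer (auto simp: ae_eq_iff_AE null_diff_iff_AE elim: eventually_elim2)
  show "x \<le> sup x y" by transfer (auto simp: ae_eq_iff_AE null_diff_iff_AE)
  show "y \<le> sup x y" by transfer (auto simp: ae_eq_iff_AE null_diff_iff_AE)
  show "sup y z \<le> x" if "y \<le> x" "z \<le> x" using that
    by transfer (auto simp: ae_eq_iff_AE null_diff_iff_AE elim: eventually_elim2)
  show "bot \<le> x" by transfer (auto simp: ae_eq_iff_AE null_diff_iff_AE)
  show "x \<le> top" by transfer (auto simp: ae_eq_iff_AE null_diff_iff_AE)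
  show "sup x (inf y z) = inf (sup x y) (sup x z)"
    by transfer (auto simp: ae_eq_iff_AE)
  show "inf x (- x) = bot" by transfer (auto simp: ae_eq_iff_AE Compl_eq_Diff_UNIV)
  show "sup x (- x) = top" by transfer (auto simp: ae_eq_iff_AE Compl_eq_Diff_UNIV)
  show "x - y = inf x (- y)" by transfer (auto simp: ae_eq_iff_AE Compl_eq_Diff_UNIV)
qed

end

lemma top_neq_bot_measure_algebra: "(top :: measure_algebra) \<noteq> bot"
  by transfer (use prob_space.emeasure_space_1[OF prob_space_coin] in
    \<open>auto simp: ae_eq_def null_sets_def\<close>)


section \<open>Names and the forcing relation\<close>

text \<open>The universe is the class of sets hereditarily of size at most the cardinality of the
  index type \<open>'i\<close>: a name is a set, indexed by (part of) \<open>'i\<close>, of pairs consisting of a name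
  and an element of the algebra. The sets and functions quantified over below are hereditarily
  countable, and a family of sets of nodes has size at most continuum, so once \<open>'i\<close> has at least
  the cardinality of the continuum, the meaning of the formulas below is the same as in the
  full universe. The forcing conditions are the nonzero elements; a pair whose
  second component is zero contributes nothing.\<close>

datatype ('i, 'b) name = Name "'i \<Rightarrow> (('i, 'b) name \<times> 'b) option"

primrec elems :: "('i, 'b) name \<Rightarrow> (('i, 'b) name \<times> 'b) set" where
  "elems (Name f) = ran f"

text \<open>The usual recursion for atomic formulas. Since names are well-founded, the recursion
  equations have exactly one solution, so nothing hinges on taking the least one.\<close>

inductive
  forces_eq :: "'b::boolean_algebra \<Rightarrow> ('i, 'b) name \<Rightarrow> ('i, 'b) name \<Rightarrow> bool" and
  forces_mem :: "'b::boolean_algebra \<Rightarrow> ('i, 'b) name \<Rightarrow> ('i, 'b) name \<Rightarrow> bool"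
where
  forces_eqI:
    "\<lbrakk>\<forall>(\<pi>, s)\<in>elems \<sigma>. \<forall>q. q \<noteq> bot \<and> q \<le> p \<and> q \<le> s \<longrightarrow> forces_mem q \<pi> \<tau>;
      \<forall>(\<pi>, s)\<in>elems \<tau>. \<forall>q. q \<noteq> bot \<and> q \<le> p \<and> q \<le> s \<longrightarrow> forces_mem q \<pi> \<sigma>\<rbrakk>
     \<Longrightarrow> forces_eq p \<sigma> \<tau>"
| forces_memI:
    "\<forall>q. q \<noteq> bot \<and> q \<le> p \<longrightarrow>
       (\<exists>r. r \<noteq> bot \<and> r \<le> q \<and> (\<exists>(\<pi>, s)\<in>elems \<tau>. r \<le> s \<and> forces_eq r \<sigma> \<pi>))
     \<Longrightarrow> forces_mem p \<sigma> \<tau>"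

text \<open>Sentences of the forcing language: constants from \<open>'n\<close>, with bound variables represented
  by functions on \<open>'n\<close>.\<close>

datatype 'n fm =
    Mem 'n 'n
  | Eq 'n 'n
  | Neg "'n fm"
  | And "'n fm" "'n fm"
  | Forall "'n \<Rightarrow> 'n fm"

primrec forces :: "('i, 'b) name fm \<Rightarrow> 'b::boolean_algebra \<Rightarrow> bool" where
  "forces (Mem \<sigma> \<tau>) = (\<lambda>p. forces_mem p \<sigma> \<tau>)"
| "forces (Eq \<sigma> \<tau>) = (\<lambda>p. forces_eq p \<sigma> \<tau>)"
| "forces (Neg \<phi>) = (\<lambda>p. \<forall>q. q \<noteq> bot \<and> q \<le> p \<longrightarrow> \<not> forces \<phi> q)"
| "forces (And \<phi> \<psi>) = (\<lambda>p. forces \<phi> p \<and> forces \<psi> p)"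
| "forces (Forall \<phi>) = (\<lambda>p. \<forall>\<tau>. forces (\<phi> \<tau>) p)"

text \<open>Truth in \<open>V[G]\<close> for every generic \<open>G\<close> over the universe \<open>V\<close>: every condition forces it.\<close>

definition holds_in_extension :: "('i, 'b::boolean_algebra) name fm \<Rightarrow> bool" where
  "holds_in_extension \<phi> \<longleftrightarrow> (\<forall>p. p \<noteq> bot \<longrightarrow> forces \<phi> p)"


section \<open>Set-theoretic formulas\<close>

definition Or :: "'n fm \<Rightarrow> 'n fm \<Rightarrow> 'n fm" where
  "Or \<phi> \<psi> = Neg (And (Neg \<phi>) (Neg \<psi>))"

definition Imp :: "'n fm \<Rightarrow> 'n fm \<Rightarrow> 'n fm" where
  "Imp \<phi> \<psi> = Neg (And \<phi> (Neg \<psi>))"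

definition Iff :: "'n fm \<Rightarrow> 'n fm \<Rightarrow> 'n fm" where
  "Iff \<phi> \<psi> = And (Imp \<phi> \<psi>) (Imp \<psi> \<phi>)"

definition Exists :: "('n \<Rightarrow> 'n fm) \<Rightarrow> 'n fm" where
  "Exists \<phi> = Neg (Forall (\<lambda>x. Neg (\<phi> x)))"

definition ForallIn :: "'n \<Rightarrow> ('n \<Rightarrow> 'n fm) \<Rightarrow> 'n fm" where
  "ForallIn a \<phi> = Forall (\<lambda>x. Imp (Mem x a) (\<phi> x))"

definition ExistsIn :: "'n \<Rightarrow> ('n \<Rightarrow> 'n fm) \<Rightarrow> 'n fm" where
  "ExistsIn a \<phi> = Exists (\<lambda>x. And (Mem x a) (\<phi> x))"

definition fm_subset :: "'n \<Rightarrow> 'n \<Rightarrow> 'n fm" where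
  "fm_subset x y = ForallIn x (\<lambda>z. Mem z y)"

definition fm_inter :: "'n \<Rightarrow> 'n \<Rightarrow> 'n \<Rightarrow> 'n fm" where
  "fm_inter z x y = Forall (\<lambda>w. Iff (Mem w z) (And (Mem w x) (Mem w y)))"

definition fm_upair :: "'n \<Rightarrow> 'n \<Rightarrow> 'n \<Rightarrow> 'n fm" where
  "fm_upair z x y = Forall (\<lambda>w. Iff (Mem w z) (Or (Eq w x) (Eq w y)))"

text \<open>\<open>z\<close> is the Kuratowski pair of \<open>x\<close> and \<open>y\<close>.\<close>

definition fm_pair :: "'n \<Rightarrow> 'n \<Rightarrow> 'n \<Rightarrow> 'n fm" where
  "fm_pair z x y =
     Exists (\<lambda>u. Exists (\<lambda>v. And (fm_upair u x x) (And (fm_upair v x y) (fm_upair z u v))))"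

definition fm_app :: "'n \<Rightarrow> 'n \<Rightarrow> 'n \<Rightarrow> 'n fm" where
  "fm_app f x y = ExistsIn f (\<lambda>z. fm_pair z x y)"

text \<open>\<open>f\<close> is a function from \<open>x\<close> to \<open>y\<close>.\<close>

definition fm_fun :: "'n \<Rightarrow> 'n \<Rightarrow> 'n \<Rightarrow> 'n fm" where
  "fm_fun f x y =
     And (ForallIn f (\<lambda>z. ExistsIn x (\<lambda>u. ExistsIn y (\<lambda>v. fm_pair z u v))))
         (ForallIn x (\<lambda>u. ExistsIn y (\<lambda>v. And (fm_app f u v)
            (Forall (\<lambda>w. Imp (fm_app f u w) (Eq w v))))))"

definition fm_bij :: "'n \<Rightarrow> 'n \<Rightarrow> 'n \<Rightarrow> 'n fm" where
  "fm_bij f x y =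
     And (fm_fun f x y)
         (ForallIn y (\<lambda>v. ExistsIn x (\<lambda>u. And (fm_app f u v)
            (Forall (\<lambda>w. Imp (fm_app f w v) (Eq w u))))))"

definition fm_transitive :: "'n \<Rightarrow> 'n fm" where
  "fm_transitive x = ForallIn x (\<lambda>y. fm_subset y x)"

definition fm_zero_or_succ :: "'n \<Rightarrow> 'n fm" where
  "fm_zero_or_succ x =
     Or (Forall (\<lambda>w. Neg (Mem w x)))
        (Exists (\<lambda>y. Forall (\<lambda>w. Iff (Mem w x) (Or (Mem w y) (Eq w y)))))"

text \<open>A natural number is an ordinal (given foundation: a transitive set of transitive sets)
  such that it and all its elements are zero or a successor.\<close>

definition fm_nat :: "'n \<Rightarrow> 'n fm" where
  "fm_nat x =
     And (And (fm_transitive x) (ForallIn x fm_transitive))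
         (And (fm_zero_or_succ x) (ForallIn x fm_zero_or_succ))"

definition fm_omega :: "'n \<Rightarrow> 'n fm" where
  "fm_omega w = Forall (\<lambda>n. Iff (Mem n w) (fm_nat n))"

definition fm_finite :: "'n \<Rightarrow> 'n fm" where
  "fm_finite x = Exists (\<lambda>n. And (fm_nat n) (Exists (\<lambda>f. fm_bij f x n)))"

text \<open>Nodes are functions from a natural number to \<open>\<omega>\<close>; for these, being an initial segment
  is inclusion.\<close>

definition fm_node :: "'n \<Rightarrow> 'n fm" where
  "fm_node s = Exists (\<lambda>w. And (fm_omega w) (ExistsIn w (\<lambda>n. fm_fun s n w)))"

definition fm_chain :: "'n \<Rightarrow> 'n fm" where
  "fm_chain c =
     And (ForallIn c fm_node)
         (ForallIn c (\<lambda>s. ForallIn c (\<lambda>t. Or (fm_subset s t) (fm_subset t s))))"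

definition fm_branch :: "'n \<Rightarrow> 'n fm" where
  "fm_branch b =
     And (fm_chain b) (Forall (\<lambda>c. Imp (And (fm_chain c) (fm_subset b c)) (Eq c b)))"

definition fm_almost_disjoint :: "'n \<Rightarrow> 'n \<Rightarrow> 'n fm" where
  "fm_almost_disjoint x y = Exists (\<lambda>z. And (fm_inter z x y) (fm_finite z))"

definition fm_off_branch :: "'n \<Rightarrow> 'n fm" where
  "fm_off_branch x =
     And (ForallIn x fm_node)
         (And (Neg (fm_finite x)) (Forall (\<lambda>b. Imp (fm_branch b) (fm_almost_disjoint x b))))"

definition fm_maximal :: "'n \<Rightarrow> 'n fm" where
  "fm_maximal F =
     Neg (Exists (\<lambda>A. And (fm_off_branch A) (ForallIn F (\<lambda>B. fm_almost_disjoint A B))))"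


section \<open>Canonical names for ground model objects\<close>

text \<open>This is the name \<open>{(x, 1) | x \<in> X}\<close>, provided \<open>X\<close> has at most as many elements as \<open>'i\<close>;
  nothing is claimed for larger sets.\<close>

definition hat :: "('i, 'b::boolean_algebra) name set \<Rightarrow> ('i, 'b) name" where
  "hat X = (SOME \<tau>. elems \<tau> = (\<lambda>x. (x, top)) ` X)"

fun nat_name :: "nat \<Rightarrow> ('i, 'b::boolean_algebra) name" where
  "nat_name n = hat (nat_name ` {..<n})"

declare nat_name.simps [simp del]

definition pair_name ::
  "('i, 'b::boolean_algebra) name \<Rightarrow> ('i, 'b) name \<Rightarrow> ('i, 'b) name" where
  "pair_name x y = hat {hat {x}, hat {x, y}}"

definition node_name :: "nat list \<Rightarrow> ('i, 'b::boolean_algebra) name" where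
  "node_name s = hat ((\<lambda>i. pair_name (nat_name i) (nat_name (s ! i))) ` {..<length s})"

definition node_set_name :: "nat list set \<Rightarrow> ('i, 'b::boolean_algebra) name" where
  "node_set_name A = hat (node_name ` A)"

definition family_name :: "nat list set set \<Rightarrow> ('i, 'b::boolean_algebra) name" where
  "family_name F = hat (node_set_name ` F)"

lemma elems_hat:
  fixes X :: "('i, 'b::boolean_algebra) name set" and h :: "'i \<Rightarrow> ('i, 'b) name"
  assumes "X \<subseteq> range h"
  shows "elems (hat X) = (\<lambda>x. (x, top)) ` X"
proof -
  have "ran (\<lambda>i. if h i \<in> X then Some (h i, top) else None) = (\<lambda>x. (x, top::'b)) ` X"
    using assms by (auto simp: ran_def)
  then have "elems (Name (\<lambda>i. if h i \<in> X then Some (h i, top) else None)) = (\<lambda>x. (x, top::'b)) ` X"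
    by simp
  then show ?thesis unfolding hat_def by (rule someI)
qed

end

theory Submission
  imports Defs
begin

text \<open>For \<open>x \<in> 2\<^sup>\<omega>\<close> let the comb of \<open>x\<close> consist of the nodes that
  leave \<open>x\<close> at their last entry, i.e. the sequences \<open>x\<restriction>n\<close> followed by \<open>1 - x(n)\<close>. The comb
  of the random real witnesses that \<open>\<O>\<close> is not maximal.

  A comb is an infinite antichain, so it meets every chain, in particular every branch of
  \<open>V[G]\<close>, in at most one node. Let \<open>B\<close> be an off-branch set of \<open>V\<close>. Every \<open>x\<close> runs through
  only finitely many nodes of \<open>B\<close>. But whenever one of the two successors of \<open>x\<restriction>n\<close>
  is in \<open>B\<close>, the random \<open>x\<close> takes it with probability at least \<open>1/2\<close>, so almost surely such a
  successor exists for only finitely many \<open>n\<close>; these include all nodes of the comb in \<open>B\<close>.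
  Hence, for almost every \<open>x\<close>, the comb of \<open>x\<close> is almost disjoint from \<open>B\<close>; as there are only
  countably many finite sets of nodes, densely many conditions decide the intersection of \<open>B\<close>
  with the generic comb to be a given finite set.\<close>

section \<open>The forcing relation\<close>

text \<open>A predicate \<open>P\<close> that persists to stronger conditions and holds at \<open>p\<close> whenever it holds
  densely below \<open>p\<close> behaves like truth in \<open>V[G]\<close>; all forced formulas are of this kind, also at
  \<open>bot\<close>, which forces everything.\<close>

definition densely :: "('b::boolean_algebra \<Rightarrow> bool) \<Rightarrow> 'b \<Rightarrow> bool" where
  "densely P p \<longleftrightarrow> (\<forall>q. q \<noteq> bot \<and> q \<le> p \<longrightarrow> (\<exists>r. r \<noteq> bot \<and> r \<le> q \<and> P r))"

lemma densely_le: "densely P p \<Longrightarrow> q \<le> p \<Longrightarrow> densely P q"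
  unfolding densely_def using order_trans by blast

lemma densely_mono: "densely P p \<Longrightarrow> (\<And>r. r \<noteq> bot \<Longrightarrow> r \<le> p \<Longrightarrow> P r \<Longrightarrow> Q r) \<Longrightarrow> densely Q p"
  unfolding densely_def by (meson order_trans)

lemma densely_densely: "densely (densely P) p \<Longrightarrow> densely P p"
  unfolding densely_def by (meson order_trans order_refl)

text \<open>Pass to a dense set of conditions where \<open>P\<close> is decided, then argue densely
  below each of them. This replaces picking a condition in the generic filter and working from
  there.\<close>

lemma densely_bind:
  "densely P p \<Longrightarrow> (\<And>r. r \<noteq> bot \<Longrightarrow> r \<le> p \<Longrightarrow> P r \<Longrightarrow> densely Q r) \<Longrightarrow> densely Q p"
  by (rule densely_densely) (rule densely_mono)

lemma densely_cong: "(\<And>r. r \<le> p \<Longrightarrow> P r \<longleftrightarrow> Q r) \<Longrightarrow> densely P p \<longleftrightarrow> densely Q p"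
  using densely_mono[of P p Q] densely_mono[of Q p P] by blast

lemma denselyI: "(\<And>r. r \<noteq> bot \<Longrightarrow> r \<le> p \<Longrightarrow> P r) \<Longrightarrow> densely P p"
  unfolding densely_def by blast

lemma denselyE:
  assumes "densely P p" "p \<noteq> bot"
  obtains r where "r \<noteq> bot" "r \<le> p" "P r"
  using assms unfolding densely_def by blast

section \<open>Forced equality and membership of names\<close>

lemma forces_eq_iff:
  "forces_eq p \<sigma> \<tau> \<longleftrightarrow>
     (\<forall>(\<pi>, s)\<in>elems \<sigma>. \<forall>q. q \<noteq> bot \<and> q \<le> p \<and> q \<le> s \<longrightarrow> forces_mem q \<pi> \<tau>) \<and>
     (\<forall>(\<pi>, s)\<in>elems \<tau>. \<forall>q. q \<noteq> bot \<and> q \<le> p \<and> q \<le> s \<longrightarrow> forces_mem q \<pi> \<sigma>)"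
  by (subst forces_eq.simps) simp

lemma forces_mem_iff:
  "forces_mem p \<sigma> \<tau> \<longleftrightarrow> densely (\<lambda>r. \<exists>(\<pi>, s)\<in>elems \<tau>. r \<le> s \<and> forces_eq r \<sigma> \<pi>) p"
  by (subst forces_mem.simps) (simp add: densely_def)

lemma forces_mem_le: "forces_mem p \<sigma> \<tau> \<Longrightarrow> q \<le> p \<Longrightarrow> forces_mem q \<sigma> \<tau>"
  unfolding forces_mem_iff by (rule densely_le)

lemma forces_mem_densely: "densely (\<lambda>r. forces_mem r \<sigma> \<tau>) p \<Longrightarrow> forces_mem p \<sigma> \<tau>"
  unfolding forces_mem_iff by (rule densely_densely)

lemma forces_eq_le:
  assumes "forces_eq p \<sigma> \<tau>" "q \<le> p" shows "forces_eq q \<sigma> \<tau>"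
proof -
  have "r \<le> p" if "r \<le> q" for r using that assms(2) by (rule order_trans)
  with assms(1) show ?thesis
    unfolding forces_eq_iff[of p] forces_eq_iff[of q] by (simp add: case_prod_unfold)
qed

lemma forces_eq_sym: "forces_eq p \<sigma> \<tau> \<Longrightarrow> forces_eq p \<tau> \<sigma>"
  unfolding forces_eq_iff[of p] by blast

lemma forces_eq_memD:
  "forces_eq p \<sigma> \<tau> \<Longrightarrow> (\<pi>, s) \<in> elems \<sigma> \<Longrightarrow> q \<noteq> bot \<Longrightarrow> q \<le> p \<Longrightarrow> q \<le> s \<Longrightarrow> forces_mem q \<pi> \<tau>"
  unfolding forces_eq_iff[of p] by fast

text \<open>Each half of an equality unfolds into membership statements, for which density is built
  in. The second half is the first one for the reversed equation.\<close>

lemma forces_eq_densely: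
  assumes "densely (\<lambda>r. forces_eq r \<sigma> \<tau>) p" shows "forces_eq p \<sigma> \<tau>"
proof -
  have *: "forces_mem q \<pi> \<tau>"
    if "densely (\<lambda>r. forces_eq r \<sigma> \<tau>) p" "(\<pi>, s) \<in> elems \<sigma>" "q \<le> p" "q \<le> s" for \<sigma> \<tau> \<pi> s q
  proof (rule forces_mem_densely)
    show "densely (\<lambda>r. forces_mem r \<pi> \<tau>) q"
    proof (rule densely_mono[OF densely_le[OF that(1,3)]])
      fix r assume r: "r \<noteq> bot" "r \<le> q" "forces_eq r \<sigma> \<tau>"
      show "forces_mem r \<pi> \<tau>"
        using forces_eq_memD[OF r(3) that(2) r(1) order_refl order_trans[OF r(2) that(4)]] .
    qed
  qed
  have "densely (\<lambda>r. forces_eq r \<tau> \<sigma>) p"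
    using assms by (rule densely_mono) (rule forces_eq_sym)
  then show ?thesis
    unfolding forces_eq_iff[of p] using *[OF assms] *[of \<tau> \<sigma>] by fast
qed

lemma forces_eq_cases:
  assumes "densely (\<lambda>r. P r \<or> Q r) p"
    and "\<And>r. r \<noteq> bot \<Longrightarrow> r \<le> p \<Longrightarrow> P r \<Longrightarrow> forces_eq r \<sigma> \<tau>"
    and "\<And>r. r \<noteq> bot \<Longrightarrow> r \<le> p \<Longrightarrow> Q r \<Longrightarrow> forces_eq r \<sigma> \<tau>"
  shows "forces_eq p \<sigma> \<tau>"
  by (rule forces_eq_densely, rule densely_mono[OF assms(1)]) (use assms(2,3) in blast)

text \<open>The datatype nests names inside functions, options and pairs, and its induction rule
  follows that nesting. Here it is repackaged as induction along membership.\<close>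

lemma name_induct:
  assumes "\<And>\<sigma>. (\<And>\<pi> s. (\<pi>, s) \<in> elems \<sigma> \<Longrightarrow> P \<pi>) \<Longrightarrow> P \<sigma>"
  shows "P \<sigma>"
proof (induction \<sigma>)
  case (Name f)
  show ?case
  proof (rule assms)
    fix \<pi> s assume "(\<pi>, s) \<in> elems (Name f)"
    then obtain i where "f i = Some (\<pi>, s)" by (auto simp: ran_def)
    then have "Some (\<pi>, s) \<in> range f" by (metis rangeI)
    then show "P \<pi>"
      using Name[of "Some (\<pi>, s)" "(\<pi>, s)" \<pi>] by simp
  qed
qed

lemma forces_eq_refl: "forces_eq p \<sigma> \<sigma>"
proof (induction \<sigma> arbitrary: p rule: name_induct)
  case (1 \<sigma>)
  have "forces_mem q \<pi> \<sigma>" if "(\<pi>, s) \<in> elems \<sigma>" "q \<le> s" for \<pi> s q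
    unfolding forces_mem_iff
  proof (rule denselyI)
    fix r assume "r \<le> q"
    with that(2) have "r \<le> s" by (rule order_trans[rotated])
    then show "\<exists>(\<pi>', s)\<in>elems \<sigma>. r \<le> s \<and> forces_eq r \<pi> \<pi>'"
      using that(1) 1[OF that(1)] by blast
  qed
  then show ?case unfolding forces_eq_iff[of p] by blast
qed

lemma forces_mem_elems:
  assumes "(\<pi>, s) \<in> elems \<tau>" "q \<le> s" shows "forces_mem q \<pi> \<tau>"
  unfolding forces_mem_iff
proof (rule denselyI)
  fix r assume "r \<le> q"
  with assms(2) have "r \<le> s" by (rule order_trans[rotated])
  then show "\<exists>(\<pi>', s)\<in>elems \<tau>. r \<le> s \<and> forces_eq r \<pi> \<pi>'"
    using assms(1) forces_eq_refl by blast
qed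

text \<open>Induction on the leftmost name with the condition and the other two names arbitrary. An
  element of \<sigma> is matched densely with an element of \<tau>, and that one with an element of
  \<rho>; the induction hypothesis composes the two matches.\<close>

lemma forces_eq_trans: "forces_eq p \<sigma> \<tau> \<Longrightarrow> forces_eq p \<tau> \<rho> \<Longrightarrow> forces_eq p \<sigma> \<rho>"
proof (induction \<sigma> arbitrary: p \<tau> \<rho> rule: name_induct)
  case (1 \<sigma>)
  have "forces_mem q \<pi> \<rho>" if "(\<pi>, s) \<in> elems \<sigma>" "q \<noteq> bot" "q \<le> p" "q \<le> s" for \<pi> s q
  proof -
    have "densely (\<lambda>r. \<exists>(\<pi>', s')\<in>elems \<tau>. r \<le> s' \<and> forces_eq r \<pi> \<pi>') q"
      using forces_eq_memD[OF 1(2) that] by (simp add: forces_mem_iff)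
    then have "densely (\<lambda>r. \<exists>(\<pi>'', s'')\<in>elems \<rho>. r \<le> s'' \<and> forces_eq r \<pi> \<pi>'') q"
    proof (rule densely_bind)
      fix r assume r: "r \<noteq> bot" "r \<le> q" "\<exists>(\<pi>', s')\<in>elems \<tau>. r \<le> s' \<and> forces_eq r \<pi> \<pi>'"
      then obtain \<pi>' s' where *: "(\<pi>', s') \<in> elems \<tau>" "r \<le> s'" "forces_eq r \<pi> \<pi>'" by blast
      have "r \<le> p" using r that by (meson order_trans)
      from forces_eq_memD[OF 1(3) *(1) r(1) this *(2)]
      have "densely (\<lambda>r. \<exists>(\<pi>'', s'')\<in>elems \<rho>. r \<le> s'' \<and> forces_eq r \<pi>' \<pi>'') r"
        by (simp add: forces_mem_iff)
      then show "densely (\<lambda>r. \<exists>(\<pi>'', s'')\<in>elems \<rho>. r \<le> s'' \<and> forces_eq r \<pi> \<pi>'') r"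
      proof (rule densely_mono)
        fix t assume "t \<le> r" "\<exists>(\<pi>'', s'')\<in>elems \<rho>. t \<le> s'' \<and> forces_eq t \<pi>' \<pi>''"
        then obtain \<pi>'' s'' where **: "(\<pi>'', s'') \<in> elems \<rho>" "t \<le> s''" "forces_eq t \<pi>' \<pi>''"
          by blast
        have "forces_eq t \<pi> \<pi>''"
          using 1(1)[OF that(1) forces_eq_le[OF *(3) \<open>t \<le> r\<close>] **(3)] .
        then show "\<exists>(\<pi>'', s'')\<in>elems \<rho>. t \<le> s'' \<and> forces_eq t \<pi> \<pi>''"
          using ** by blast
      qed
    qed
    then show ?thesis by (simp add: forces_mem_iff)
  qed
  moreover have "forces_mem q \<pi> \<sigma>" if "(\<pi>, s) \<in> elems \<rho>" "q \<noteq> bot" "q \<le> p" "q \<le> s" for \<pi> s q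
  proof -
    have "densely (\<lambda>r. \<exists>(\<pi>', s')\<in>elems \<tau>. r \<le> s' \<and> forces_eq r \<pi> \<pi>') q"
      using forces_eq_memD[OF forces_eq_sym[OF 1(3)] that] by (simp add: forces_mem_iff)
    then have "densely (\<lambda>r. \<exists>(\<pi>'', s'')\<in>elems \<sigma>. r \<le> s'' \<and> forces_eq r \<pi> \<pi>'') q"
    proof (rule densely_bind)
      fix r assume r: "r \<noteq> bot" "r \<le> q" "\<exists>(\<pi>', s')\<in>elems \<tau>. r \<le> s' \<and> forces_eq r \<pi> \<pi>'"
      then obtain \<pi>' s' where *: "(\<pi>', s') \<in> elems \<tau>" "r \<le> s'" "forces_eq r \<pi> \<pi>'" by blast
      have "r \<le> p" using r that by (meson order_trans)
      from forces_eq_memD[OF forces_eq_sym[OF 1(2)] *(1) r(1) this *(2)]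
      have "densely (\<lambda>r. \<exists>(\<pi>'', s'')\<in>elems \<sigma>. r \<le> s'' \<and> forces_eq r \<pi>' \<pi>'') r"
        by (simp add: forces_mem_iff)
      then show "densely (\<lambda>r. \<exists>(\<pi>'', s'')\<in>elems \<sigma>. r \<le> s'' \<and> forces_eq r \<pi> \<pi>'') r"
      proof (rule densely_mono)
        fix t assume "t \<le> r" "\<exists>(\<pi>'', s'')\<in>elems \<sigma>. t \<le> s'' \<and> forces_eq t \<pi>' \<pi>''"
        then obtain \<pi>'' s'' where **: "(\<pi>'', s'') \<in> elems \<sigma>" "t \<le> s''" "forces_eq t \<pi>' \<pi>''"
          by blast
        \<comment> \<open>The induction hypothesis covers only elements of \<sigma>, here \<pi>'',
          so the two equations are composed starting from that end.\<close>
        have "forces_eq t \<pi>'' \<pi>"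
          using 1(1)[OF **(1) forces_eq_sym[OF **(3)] forces_eq_sym[OF forces_eq_le[OF *(3) \<open>t \<le> r\<close>]]] .
        then show "\<exists>(\<pi>'', s'')\<in>elems \<sigma>. t \<le> s'' \<and> forces_eq t \<pi> \<pi>''"
          using ** forces_eq_sym by blast
      qed
    qed
    then show ?thesis by (simp add: forces_mem_iff)
  qed
  ultimately show ?case unfolding forces_eq_iff[of p] by blast
qed

lemma forces_mem_cong_left:
  assumes "forces_eq p \<sigma> \<sigma>'" "forces_mem p \<sigma> \<tau>" shows "forces_mem p \<sigma>' \<tau>"
  unfolding forces_mem_iff
proof (rule densely_mono[OF assms(2)[unfolded forces_mem_iff]])
  fix r assume "r \<le> p" "\<exists>(\<pi>, s)\<in>elems \<tau>. r \<le> s \<and> forces_eq r \<sigma> \<pi>"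
  moreover have "forces_eq r \<sigma>' \<sigma>"
    using forces_eq_le[OF assms(1) \<open>r \<le> p\<close>] by (rule forces_eq_sym)
  ultimately show "\<exists>(\<pi>, s)\<in>elems \<tau>. r \<le> s \<and> forces_eq r \<sigma>' \<pi>"
    using forces_eq_trans by blast
qed

lemma forces_mem_cong_right:
  assumes "forces_eq p \<tau> \<tau>'" "forces_mem p \<sigma> \<tau>" shows "forces_mem p \<sigma> \<tau>'"
proof (rule forces_mem_densely)
  show "densely (\<lambda>r. forces_mem r \<sigma> \<tau>') p"
  proof (rule densely_mono[OF assms(2)[unfolded forces_mem_iff]])
    fix r assume r: "r \<noteq> bot" "r \<le> p" "\<exists>(\<pi>, s)\<in>elems \<tau>. r \<le> s \<and> forces_eq r \<sigma> \<pi>"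
    then obtain \<pi> s where "(\<pi>, s) \<in> elems \<tau>" "r \<le> s" "forces_eq r \<sigma> \<pi>" by blast
    then show "forces_mem r \<sigma> \<tau>'"
      using forces_eq_memD[OF assms(1) _ r(1,2)] forces_mem_cong_left forces_eq_sym by blast
  qed
qed

lemma forces_eqI_ext:
  assumes "\<And>q \<pi>. q \<noteq> bot \<Longrightarrow> q \<le> p \<Longrightarrow> forces_mem q \<pi> \<sigma> \<longleftrightarrow> forces_mem q \<pi> \<tau>"
  shows "forces_eq p \<sigma> \<tau>"
  unfolding forces_eq_iff[of p] using assms forces_mem_elems by fast

section \<open>Persistence, density and the derived connectives\<close>

lemma forces_le: "forces \<phi> p \<Longrightarrow> q \<le> p \<Longrightarrow> forces \<phi> q"
proof (induction \<phi> arbitrary: p q)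
  case (Neg \<phi>)
  then show ?case by (auto intro: order_trans)
next
  case (Forall \<phi>)
  then show ?case by (metis forces.simps(5) rangeI)
qed (auto intro: forces_mem_le forces_eq_le)

text \<open>The atomic cases are known. For a negation, a condition below \<open>p\<close> forcing
  the negated formula would have an extension forcing both the formula and its negation.\<close>

lemma forces_densely: "densely (forces \<phi>) p \<Longrightarrow> forces \<phi> p"
proof (induction \<phi> arbitrary: p)
  case (Neg \<phi>)
  show ?case unfolding forces.simps
  proof (intro allI impI notI)
    fix q assume q: "q \<noteq> bot \<and> q \<le> p" "forces \<phi> q"
    with Neg.prems obtain r where "r \<noteq> bot" "r \<le> q" "forces (Neg \<phi>) r"
      unfolding densely_def by blast
    then show False using forces_le[OF q(2)] by auto
  qed
next
  case (And \<phi> \<psi>)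
  have "densely (forces \<phi>) p" "densely (forces \<psi>) p"
    by (rule densely_mono[OF And.prems], simp)+
  then show ?case using And.IH by simp
next
  case (Forall \<phi>)
  have "densely (forces (\<phi> \<tau>)) p" for \<tau>
    by (rule densely_mono[OF Forall.prems]) simp
  then show ?case using Forall.IH by simp
qed (auto intro: forces_mem_densely forces_eq_densely)

text \<open>Unfolding \<open>Imp\<close> yields the conclusion only densely below \<open>q\<close>,
  and \<open>forces_densely\<close> upgrades this. The quantifier may include
  \<open>q = bot\<close>, since density is vacuous there and \<open>bot\<close> forces every
  formula.\<close>

lemma forces_Imp: "forces (Imp \<phi> \<psi>) p \<longleftrightarrow> (\<forall>q\<le>p. forces \<phi> q \<longrightarrow> forces \<psi> q)"
proof (intro iffI allI impI)
  fix q assume *: "forces (Imp \<phi> \<psi>) p" "q \<le> p" "forces \<phi> q"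
  show "forces \<psi> q"
  proof (rule forces_densely, unfold densely_def, intro allI impI)
    fix r assume "r \<noteq> bot \<and> r \<le> q"
    then show "\<exists>r'. r' \<noteq> bot \<and> r' \<le> r \<and> forces \<psi> r'"
      using * forces_le[OF *(3)] unfolding Imp_def forces.simps by (meson order_trans)
  qed
next
  assume "\<forall>q\<le>p. forces \<phi> q \<longrightarrow> forces \<psi> q"
  then show "forces (Imp \<phi> \<psi>) p" unfolding Imp_def forces.simps by blast
qed

lemma forces_Iff: "forces (Iff \<phi> \<psi>) p \<longleftrightarrow> (\<forall>q\<le>p. forces \<phi> q \<longleftrightarrow> forces \<psi> q)"
  by (auto simp: Iff_def forces_Imp)

lemma forces_Or: "forces (Or \<phi> \<psi>) p \<longleftrightarrow> densely (\<lambda>r. forces \<phi> r \<or> forces \<psi> r) p"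
  unfolding Or_def densely_def forces.simps by (meson order_trans forces_le order_refl)

lemma forces_Exists: "forces (Exists \<phi>) p \<longleftrightarrow> densely (\<lambda>r. \<exists>x. forces (\<phi> x) r) p"
  unfolding Exists_def densely_def forces.simps by (meson order_trans forces_le order_refl)

lemma forces_ForallIn:
  "forces (ForallIn a \<phi>) p \<longleftrightarrow> (\<forall>x. \<forall>q\<le>p. forces_mem q x a \<longrightarrow> forces (\<phi> x) q)"
  by (auto simp: ForallIn_def forces_Imp)

lemma forces_ExistsIn:
  "forces (ExistsIn a \<phi>) p \<longleftrightarrow> densely (\<lambda>r. \<exists>x. forces_mem r x a \<and> forces (\<phi> x) r) p"
  by (simp add: ExistsIn_def forces_Exists)

lemma forces_subset:
  "forces (fm_subset a b) p \<longleftrightarrow> (\<forall>x. \<forall>q\<le>p. forces_mem q x a \<longrightarrow> forces_mem q x b)"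
  by (simp add: fm_subset_def forces_ForallIn)

text \<open>Bound variables are represented by arbitrary functions on names, and such a function
  need not respect forced equality. This predicate singles out those that do.\<close>

definition extensional_fm :: "(('i, 'b::boolean_algebra) name \<Rightarrow> ('i, 'b) name fm) \<Rightarrow> bool" where
  "extensional_fm \<phi> \<longleftrightarrow> (\<forall>p \<sigma> \<tau>. forces_eq p \<sigma> \<tau> \<longrightarrow> forces (\<phi> \<sigma>) p \<longrightarrow> forces (\<phi> \<tau>) p)"

lemma extensional_fmD: "extensional_fm \<phi> \<Longrightarrow> forces_eq p \<sigma> \<tau> \<Longrightarrow> forces (\<phi> \<sigma>) p \<Longrightarrow> forces (\<phi> \<tau>) p"
  unfolding extensional_fm_def by blast

text \<open>One rule for each way of building a formula, so that any concrete formula is handled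
  after unfolding it to the primitive constructors with \<open>fm_defs\<close>.\<close>

lemma extensional_fm_intros:
  "extensional_fm (\<lambda>x. \<eta>)"
  "extensional_fm (\<lambda>x. Mem x \<tau>)" "extensional_fm (\<lambda>x. Mem \<tau> x)"
  "extensional_fm (\<lambda>x. Eq x \<tau>)" "extensional_fm (\<lambda>x. Eq \<tau> x)"
  "extensional_fm \<phi> \<Longrightarrow> extensional_fm (\<lambda>x. Neg (\<phi> x))"
  "extensional_fm \<phi> \<Longrightarrow> extensional_fm \<psi> \<Longrightarrow> extensional_fm (\<lambda>x. And (\<phi> x) (\<psi> x))"
  "(\<And>y. extensional_fm (\<lambda>x. \<theta> x y)) \<Longrightarrow> extensional_fm (\<lambda>x. Forall (\<theta> x))"
proof -
  show "extensional_fm (\<lambda>x. Neg (\<phi> x))" if "extensional_fm \<phi>"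
    unfolding extensional_fm_def forces.simps
  proof (intro allI impI notI)
    fix p \<sigma> \<tau> q
    assume *: "forces_eq p \<sigma> \<tau>" "\<forall>q. q \<noteq> bot \<and> q \<le> p \<longrightarrow> \<not> forces (\<phi> \<sigma>) q" "q \<noteq> bot \<and> q \<le> p"
      "forces (\<phi> \<tau>) q"
    \<comment> \<open>Negation reverses direction, so the hypothesis on the negated formula is
      applied to the reversed equation.\<close>
    then have "forces_eq q \<tau> \<sigma>" by (blast intro: forces_eq_le forces_eq_sym)
    with * that show False by (blast dest: extensional_fmD)
  qed
qed (auto simp: extensional_fm_def intro: forces_mem_cong_left forces_mem_cong_right
    forces_eq_trans[OF forces_eq_sym] forces_eq_trans)

lemmas fm_defs = fm_inter_def fm_finite_def fm_almost_disjoint_def fm_off_branch_def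
  fm_branch_def fm_chain_def fm_node_def fm_omega_def fm_nat_def fm_zero_or_succ_def
  fm_transitive_def fm_bij_def fm_fun_def fm_app_def fm_pair_def fm_upair_def fm_subset_def
  ExistsIn_def ForallIn_def Exists_def Iff_def Imp_def Or_def

text \<open>An arbitrary forced member of \<open>a\<close> is densely equal to one of the listed
  names, and an extensional formula transfers along that equality. Bounded quantifiers thus reduce
  to the pairs in the name.\<close>

lemma forces_ForallIn_elems:
  assumes "extensional_fm \<phi>"
  shows "forces (ForallIn a \<phi>) p \<longleftrightarrow> (\<forall>(\<pi>, s)\<in>elems a. \<forall>q\<le>p. q \<le> s \<longrightarrow> forces (\<phi> \<pi>) q)"
proof
  assume "forces (ForallIn a \<phi>) p"
  then show "\<forall>(\<pi>, s)\<in>elems a. \<forall>q\<le>p. q \<le> s \<longrightarrow> forces (\<phi> \<pi>) q"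
    unfolding forces_ForallIn using forces_mem_elems by fast
next
  assume *: "\<forall>(\<pi>, s)\<in>elems a. \<forall>q\<le>p. q \<le> s \<longrightarrow> forces (\<phi> \<pi>) q"
  show "forces (ForallIn a \<phi>) p" unfolding forces_ForallIn
  proof (intro allI impI)
    fix x q assume q: "q \<le> p" "forces_mem q x a"
    show "forces (\<phi> x) q"
    proof (rule forces_densely)
      from q(2) show "densely (forces (\<phi> x)) q"
        unfolding forces_mem_iff
      proof (rule densely_mono)
        fix r assume "r \<le> q" "\<exists>(\<pi>, s)\<in>elems a. r \<le> s \<and> forces_eq r x \<pi>"
        then obtain \<pi> s where "(\<pi>, s) \<in> elems a" "r \<le> s" "forces_eq r x \<pi>" by blast
        then show "forces (\<phi> x) r"
          using * order_trans[OF \<open>r \<le> q\<close> q(1)] extensional_fmD[OF assms forces_eq_sym] by blast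
      qed
    qed
  qed
qed

lemma forces_ExistsInI:
  assumes "(\<pi>, top) \<in> elems a" "forces (\<phi> \<pi>) p"
  shows "forces (ExistsIn a \<phi>) p"
  unfolding forces_ExistsIn
  by (rule denselyI) (meson assms forces_le forces_mem_elems top_greatest)

lemma forces_ExistsI: "forces (\<phi> x) p \<Longrightarrow> forces (Exists \<phi>) p"
  unfolding forces_Exists by (rule denselyI) (use forces_le in fast)

text \<open>Unordered pairs, successors and \<omega> are all described by listing their members.
  Once the members of a candidate name \<tau> are computed, such a description is forced exactly
  where equality with \<tau> is.\<close>

lemma forces_defining:
  assumes "\<And>q w. q \<le> p \<Longrightarrow> forces_mem q w \<tau> \<longleftrightarrow> forces (\<phi> w) q"
  shows "forces (Forall (\<lambda>w. Iff (Mem w z) (\<phi> w))) p \<longleftrightarrow> forces_eq p z \<tau>"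
proof
  assume "forces (Forall (\<lambda>w. Iff (Mem w z) (\<phi> w))) p"
  then show "forces_eq p z \<tau>"
    by (intro forces_eqI_ext) (use assms in \<open>auto simp: forces_Iff\<close>)
next
  assume *: "forces_eq p z \<tau>"
  have "forces_mem q w z \<longleftrightarrow> forces_mem q w \<tau>" if "q \<le> p" for q w
    using forces_eq_le[OF * that] by (blast intro: forces_mem_cong_right forces_eq_sym)
  then show "forces (Forall (\<lambda>w. Iff (Mem w z) (\<phi> w))) p"
    using assms by (auto simp: forces_Iff)
qed

lemma extensional_fms:
  "extensional_fm fm_nat" "extensional_fm fm_node" "extensional_fm fm_transitive"
  "extensional_fm fm_zero_or_succ"
  "extensional_fm (fm_almost_disjoint x)"
  "extensional_fm (\<lambda>z. fm_subset z x)"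
  unfolding fm_defs[abs_def] by (intro extensional_fm_intros)+

section \<open>Canonical names\<close>

text \<open>The forced counterpart of injectivity on \<open>U\<close>. It makes graph names
  single-valued, and in the other coordinate one-to-one.\<close>

definition separated :: "('a \<Rightarrow> ('i, 'b::boolean_algebra) name) \<Rightarrow> 'a set \<Rightarrow> bool" where
  "separated a U \<longleftrightarrow> (\<forall>u\<in>U. \<forall>v\<in>U. \<forall>r. r \<noteq> bot \<longrightarrow> forces_eq r (a u) (a v) \<longrightarrow> u = v)"

lemma separatedD:
  "separated a U \<Longrightarrow> forces_eq r (a u) (a v) \<Longrightarrow> r \<noteq> bot \<Longrightarrow> u \<in> U \<Longrightarrow> v \<in> U \<Longrightarrow> u = v"
  unfolding separated_def by blast

text \<open>The function sending each \<open>a u\<close> to \<open>b u\<close>. Node names and the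
  bijections that witness finiteness are instances.\<close>

definition graph_name ::
  "('a \<Rightarrow> ('i, 'b::boolean_algebra) name) \<Rightarrow> ('a \<Rightarrow> ('i, 'b) name) \<Rightarrow> 'a set \<Rightarrow> ('i, 'b) name" where
  "graph_name a b U = hat ((\<lambda>u. pair_name (a u) (b u)) ` U)"

lemma forces_mem_hat_if:
  assumes "elems (hat X) = (\<lambda>x. (x, top)) ` X"
  shows "forces_mem p w (hat X) \<longleftrightarrow> densely (\<lambda>r. \<exists>x\<in>X. forces_eq r w x) p"
  unfolding forces_mem_iff assms by simp

section \<open>Canonical names of countable sets\<close>

context
  assumes infinite_index: "infinite (UNIV :: 'i set)"
begin

text \<open>An infinite index type contains a copy of the naturals; mapping back along it and then
  enumerating \<open>X\<close> gives the indexing that \<open>elems_hat\<close> asks for.\<close>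

lemma elems_hat_countable:
  fixes X :: "('i, 'b::boolean_algebra) name set"
  assumes "countable X"
  shows "elems (hat X) = (\<lambda>x. (x, top)) ` X"
proof (cases "X = {}")
  case False
  obtain g :: "nat \<Rightarrow> 'i" where g: "inj g"
    using infinite_index infinite_countable_subset by blast
  have "X \<subseteq> range (from_nat_into X \<circ> inv g)"
  proof
    fix x assume "x \<in> X"
    then obtain n where "x = from_nat_into X n"
      using assms False range_from_nat_into by (metis imageE)
    then have "x = (from_nat_into X \<circ> inv g) (g n)" using g by simp
    then show "x \<in> range (from_nat_into X \<circ> inv g)" by (rule range_eqI)
  qed
  then show ?thesis by (rule elems_hat)
qed (use elems_hat[of "{}"] in simp)

lemma forces_mem_hat:
  fixes X :: "('i, 'b::boolean_algebra) name set"
  assumes "countable X"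
  shows "forces_mem p w (hat X) \<longleftrightarrow> densely (\<lambda>r. \<exists>x\<in>X. forces_eq r w x) p"
  by (rule forces_mem_hat_if) (rule elems_hat_countable[OF assms])

lemma elem_hat:
  fixes X :: "('i, 'b::boolean_algebra) name set"
  shows "countable X \<Longrightarrow> x \<in> X \<Longrightarrow> (x, top) \<in> elems (hat X)"
  by (simp add: elems_hat_countable)

lemma forces_mem_hatI:
  fixes X :: "('i, 'b::boolean_algebra) name set"
  shows "countable X \<Longrightarrow> x \<in> X \<Longrightarrow> forces_mem p x (hat X)"
  by (rule forces_mem_elems[OF elem_hat top_greatest])

lemma forces_ForallIn_hat:
  fixes X :: "('i, 'b::boolean_algebra) name set"
  assumes "countable X" "extensional_fm \<phi>"
  shows "forces (ForallIn (hat X) \<phi>) p \<longleftrightarrow> (\<forall>x\<in>X. forces (\<phi> x) p)"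
  unfolding forces_ForallIn_elems[OF assms(2)] elems_hat_countable[OF assms(1)]
  using forces_le by auto

lemma forces_ExistsIn_hatI:
  fixes X :: "('i, 'b::boolean_algebra) name set"
  shows "countable X \<Longrightarrow> x \<in> X \<Longrightarrow> forces (\<phi> x) p \<Longrightarrow> forces (ExistsIn (hat X) \<phi>) p"
  by (rule forces_ExistsInI[OF elem_hat])

lemma forces_eq_hatI:
  fixes X :: "('i, 'b::boolean_algebra) name set"
  assumes "countable X" "countable Y"
    and "\<And>x. x \<in> X \<Longrightarrow> \<exists>y\<in>Y. forces_eq p x y" "\<And>y. y \<in> Y \<Longrightarrow> \<exists>x\<in>X. forces_eq p x y"
  shows "forces_eq p (hat X) (hat Y)"
proof (rule forces_eqI_ext)
  fix q \<pi> assume q: "q \<le> p"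
  have "\<exists>y\<in>Y. forces_eq r \<pi> y" if "r \<le> q" "\<exists>x\<in>X. forces_eq r \<pi> x" for r
    using that(2) assms(3) order_trans[OF that(1) q] by (meson forces_eq_le forces_eq_trans)
  moreover have "\<exists>x\<in>X. forces_eq r \<pi> x" if "r \<le> q" "\<exists>y\<in>Y. forces_eq r \<pi> y" for r
    using that(2) assms(4) order_trans[OF that(1) q]
    by (meson forces_eq_le forces_eq_trans forces_eq_sym)
  ultimately show "forces_mem q \<pi> (hat X) = forces_mem q \<pi> (hat Y)"
    unfolding forces_mem_hat[OF assms(1)] forces_mem_hat[OF assms(2)]
    by (intro densely_cong) blast
qed

section \<open>Ordered pairs and functions\<close>

lemma forces_mem_singleton:
  "forces_mem p w (hat {x :: ('i, 'b::boolean_algebra) name}) \<longleftrightarrow> forces_eq p w x"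
proof
  assume "forces_mem p w (hat {x})"
  then show "forces_eq p w x"
    by (intro forces_eq_densely) (simp add: forces_mem_hat)
next
  assume "forces_eq p w x"
  moreover have "forces_mem p x (hat {x})" by (rule forces_mem_hatI) auto
  ultimately show "forces_mem p w (hat {x})"
    by (blast intro: forces_mem_cong_left forces_eq_sym)
qed

lemma forces_mem_doubleton:
  "forces_mem p w (hat {x :: ('i, 'b::boolean_algebra) name, y}) \<longleftrightarrow>
     densely (\<lambda>r. forces_eq r w x \<or> forces_eq r w y) p"
  by (simp add: forces_mem_hat)

lemma forces_upair:
  fixes x :: "('i, 'b::boolean_algebra) name"
  shows "forces (fm_upair z x y) p \<longleftrightarrow> forces_eq p z (hat {x, y})"
  unfolding fm_upair_def
  by (rule forces_defining) (simp add: forces_mem_doubleton forces_Or)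

lemma forces_pair:
  fixes x :: "('i, 'b::boolean_algebra) name"
  shows "forces (fm_pair z x y) p \<longleftrightarrow> forces_eq p z (pair_name x y)"
proof
  assume *: "forces (fm_pair z x y) p"
  show "forces_eq p z (pair_name x y)"
  proof (rule forces_eq_densely)
    show "densely (\<lambda>r. forces_eq r z (pair_name x y)) p"
      using *[unfolded fm_pair_def forces_Exists]
    proof (rule densely_bind)
      fix r assume "\<exists>u. densely (\<lambda>r. \<exists>v. forces (And (fm_upair u x x) (And (fm_upair v x y) (fm_upair z u v))) r) r"
      then obtain u where "densely (\<lambda>r. \<exists>v. forces (And (fm_upair u x x) (And (fm_upair v x y) (fm_upair z u v))) r) r"
        by blast
      then show "densely (\<lambda>r. forces_eq r z (pair_name x y)) r"
      proof (rule densely_mono)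
        fix r assume "\<exists>v. forces (And (fm_upair u x x) (And (fm_upair v x y) (fm_upair z u v))) r"
        then obtain v where v: "forces_eq r u (hat {x})" "forces_eq r v (hat {x, y})" "forces_eq r z (hat {u, v})"
          by (auto simp: forces_upair)
        have "forces_eq r (hat {u, v}) (pair_name x y)"
          unfolding pair_name_def by (rule forces_eq_hatI) (use v in auto)
        then show "forces_eq r z (pair_name x y)" using v(3) forces_eq_trans by blast
      qed
    qed
  qed
next
  assume "forces_eq p z (pair_name x y)"
  then show "forces (fm_pair z x y) p"
    unfolding fm_pair_def pair_name_def
    by (intro forces_ExistsI[where x="hat {x}"] forces_ExistsI[where x="hat {x, y}"])
      (simp add: forces_upair forces_eq_refl)
qed

text \<open>The usual argument for Kuratowski pairs, with each case distinction made densely. The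
  singleton \<open>{x}\<close> equals \<open>{x'}\<close> or \<open>{x', y'}\<close>, and both give
  \<open>x = x'\<close>; the doubleton gives \<open>y = x'\<close> or \<open>y = y'\<close>.\<close>

lemma forces_eq_pair_name:
  fixes x :: "('i, 'b::boolean_algebra) name"
  shows "forces_eq p (pair_name x y) (pair_name x' y') \<longleftrightarrow> forces_eq p x x' \<and> forces_eq p y y'"
proof
  have fst: "forces_eq p x x'" if "forces_eq p (pair_name x y) (pair_name x' y')"
    for p :: 'b and x y x' y' :: "('i, 'b) name"
  proof -
    have "forces_mem p (hat {x}) (pair_name x y)"
      unfolding pair_name_def by (rule forces_mem_hatI) auto
    then have "forces_mem p (hat {x}) (pair_name x' y')"
      using that forces_mem_cong_right by blast
    then have "densely (\<lambda>r. forces_eq r (hat {x}) (hat {x'}) \<or> forces_eq r (hat {x}) (hat {x', y'})) p"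
      unfolding pair_name_def forces_mem_doubleton .
    then show ?thesis
    proof (rule forces_eq_cases)
      fix r assume "forces_eq r (hat {x}) (hat {x'})"
      then show "forces_eq r x x'"
        by (metis forces_mem_cong_right forces_mem_singleton forces_eq_refl)
    next
      fix r assume eq: "forces_eq r (hat {x}) (hat {x', y'})"
      have "forces_mem r x' (hat {x', y'})" by (rule forces_mem_hatI) auto
      then show "forces_eq r x x'"
        using eq by (metis forces_mem_cong_right forces_mem_singleton forces_eq_sym)
    qed
  qed
  have snd: "densely (\<lambda>r. forces_eq r y x' \<or> forces_eq r y y') p"
    if "forces_eq p (pair_name x y) (pair_name x' y')"
    for p :: 'b and x y x' y' :: "('i, 'b) name"
  proof -
    have "forces_mem p (hat {x, y}) (pair_name x y)"
      unfolding pair_name_def by (rule forces_mem_hatI) auto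
    then have "forces_mem p (hat {x, y}) (pair_name x' y')"
      using that forces_mem_cong_right by blast
    then have "densely (\<lambda>r. forces_eq r (hat {x, y}) (hat {x'}) \<or> forces_eq r (hat {x, y}) (hat {x', y'})) p"
      unfolding pair_name_def forces_mem_doubleton .
    then show ?thesis
    proof (rule densely_bind)
      fix r assume eq: "forces_eq r (hat {x, y}) (hat {x'}) \<or> forces_eq r (hat {x, y}) (hat {x', y'})"
      have mem: "forces_mem r y (hat {x, y})" by (rule forces_mem_hatI) auto
      from eq show "densely (\<lambda>r. forces_eq r y x' \<or> forces_eq r y y') r"
      proof
        assume "forces_eq r (hat {x, y}) (hat {x'})"
        with mem have "forces_eq r y x'" by (metis forces_mem_cong_right forces_mem_singleton)
        then show ?thesis by (intro denselyI) (blast intro: forces_eq_le)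
      next
        assume "forces_eq r (hat {x, y}) (hat {x', y'})"
        with mem show ?thesis unfolding forces_mem_doubleton[symmetric]
          by (metis forces_mem_cong_right)
      qed
    qed
  qed
  assume eq: "forces_eq p (pair_name x y) (pair_name x' y')"
  have "forces_eq p y y'" using snd[OF eq]
  proof (rule forces_eq_cases)
    fix r assume r: "r \<le> p" "forces_eq r y x'"
    have eqr: "forces_eq r (pair_name x y) (pair_name x' y')" using eq r(1) by (rule forces_eq_le)
    \<comment> \<open>In the case \<open>y = x'\<close> the pairs are compared in the other
      direction: either \<open>y' = y\<close>, or \<open>y' = x\<close>, and then
      \<open>y' = x = x' = y\<close>.\<close>
    show "forces_eq r y y'" using snd[OF forces_eq_sym[OF eqr]]
    proof (rule forces_eq_cases)
      fix t assume t: "t \<le> r" "forces_eq t y' x"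
      have "forces_eq t x x'" "forces_eq t y x'"
        using fst[OF eqr] r(2) t(1) by (blast intro: forces_eq_le)+
      with t(2) show "forces_eq t y y'" by (metis forces_eq_sym forces_eq_trans)
    qed (rule forces_eq_sym)
  qed
  with fst[OF eq] show "forces_eq p x x' \<and> forces_eq p y y'" by blast
next
  assume *: "forces_eq p x x' \<and> forces_eq p y y'"
  then have "forces_eq p (hat {x, y}) (hat {x', y'})" "forces_eq p (hat {x}) (hat {x'})"
    by (auto intro!: forces_eq_hatI)
  then show "forces_eq p (pair_name x y) (pair_name x' y')"
    unfolding pair_name_def by (intro forces_eq_hatI) auto
qed

lemma forces_app:
  fixes x :: "('i, 'b::boolean_algebra) name"
  shows "forces (fm_app f x y) p \<longleftrightarrow> forces_mem p (pair_name x y) f"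
  unfolding fm_app_def forces_ExistsIn forces_pair
proof
  assume "densely (\<lambda>r. \<exists>z. forces_mem r z f \<and> forces_eq r z (pair_name x y)) p"
  then show "forces_mem p (pair_name x y) f"
    by (intro forces_mem_densely, elim densely_mono) (blast intro: forces_mem_cong_left)
next
  assume "forces_mem p (pair_name x y) f"
  then show "densely (\<lambda>r. \<exists>z. forces_mem r z f \<and> forces_eq r z (pair_name x y)) p"
    by (intro denselyI) (blast intro: forces_mem_le forces_eq_refl)
qed

lemma forces_mem_graph_name:
  fixes a :: "'a \<Rightarrow> ('i, 'b::boolean_algebra) name"
  assumes "countable U"
  shows "forces_mem p (pair_name x y) (graph_name a b U) \<longleftrightarrow>
    densely (\<lambda>r. \<exists>u\<in>U. forces_eq r x (a u) \<and> forces_eq r y (b u)) p"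
  unfolding graph_name_def using assms by (simp add: forces_mem_hat forces_eq_pair_name)

lemma forces_mem_graph_nameI:
  fixes a :: "'a \<Rightarrow> ('i, 'b::boolean_algebra) name"
  shows "countable U \<Longrightarrow> u \<in> U \<Longrightarrow> forces_mem p (pair_name (a u) (b u)) (graph_name a b U)"
  unfolding graph_name_def by (rule forces_mem_hatI) auto

text \<open>Single-valuedness comes from the separation of \<open>a\<close>: a value at
  \<open>a u\<close> can densely be attributed only to the index \<open>u\<close>. The codomain may
  exceed the image, as for nodes, which map into \<omega>.\<close>

lemma forces_fun_graph_name:
  fixes a :: "'a \<Rightarrow> ('i, 'b::boolean_algebra) name"
  assumes U: "countable U" and Y: "countable Y" "b ` U \<subseteq> Y" and a: "separated a U"
  shows "forces (fm_fun (graph_name a b U) (hat (a ` U)) (hat Y)) p"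
proof -
  have "forces (ForallIn (graph_name a b U) (\<lambda>z. ExistsIn (hat (a ` U)) (\<lambda>u. ExistsIn (hat Y) (\<lambda>v. fm_pair z u v)))) p"
    unfolding graph_name_def
  proof (subst forces_ForallIn_hat)
    show "extensional_fm (\<lambda>z. ExistsIn (hat (a ` U)) (\<lambda>u. ExistsIn (hat Y) (\<lambda>v. fm_pair z u v)))"
      unfolding fm_defs[abs_def] by (intro extensional_fm_intros)
    show "\<forall>x\<in>(\<lambda>u. pair_name (a u) (b u)) ` U. forces (ExistsIn (hat (a ` U)) (\<lambda>u. ExistsIn (hat Y) (fm_pair x u))) p"
    proof
      fix x assume "x \<in> (\<lambda>u. pair_name (a u) (b u)) ` U"
      then obtain u where u: "u \<in> U" "x = pair_name (a u) (b u)" by blast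
      show "forces (ExistsIn (hat (a ` U)) (\<lambda>u. ExistsIn (hat Y) (fm_pair x u))) p"
        by (rule forces_ExistsIn_hatI[where x="a u"], use U u in simp, use u in simp,
            rule forces_ExistsIn_hatI[where x="b u"], rule Y, use u Y in blast)
          (simp add: forces_pair u forces_eq_refl)
    qed
  qed (use U in simp)
  moreover have "forces (ForallIn (hat (a ` U)) (\<lambda>u. ExistsIn (hat Y) (\<lambda>v. And (fm_app (graph_name a b U) u v)
      (Forall (\<lambda>w. Imp (fm_app (graph_name a b U) u w) (Eq w v)))))) p"
  proof (subst forces_ForallIn_hat)
    show "extensional_fm (\<lambda>u. ExistsIn (hat Y) (\<lambda>v. And (fm_app (graph_name a b U) u v)
      (Forall (\<lambda>w. Imp (fm_app (graph_name a b U) u w) (Eq w v)))))"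
      unfolding fm_defs[abs_def] by (intro extensional_fm_intros)
    show "\<forall>x\<in>a ` U. forces (ExistsIn (hat Y) (\<lambda>v. And (fm_app (graph_name a b U) x v)
      (Forall (\<lambda>w. Imp (fm_app (graph_name a b U) x w) (Eq w v))))) p"
    proof
      fix x assume "x \<in> a ` U"
      then obtain u where u: "u \<in> U" "x = a u" by blast
      have "forces_eq q w (b u)" if "forces_mem q (pair_name x w) (graph_name a b U)" for q w
        using that unfolding forces_mem_graph_name[OF U]
        by (intro forces_eq_densely, elim densely_mono) (use u separatedD[OF a] in blast)
      then have "forces (And (fm_app (graph_name a b U) x (b u))
          (Forall (\<lambda>w. Imp (fm_app (graph_name a b U) x w) (Eq w (b u))))) p"
        using u forces_mem_graph_nameI[OF U] by (simp add: forces_app forces_Imp)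
      then show "forces (ExistsIn (hat Y) (\<lambda>v. And (fm_app (graph_name a b U) x v)
          (Forall (\<lambda>w. Imp (fm_app (graph_name a b U) x w) (Eq w v))))) p"
        by (rule forces_ExistsIn_hatI[where x="b u", rotated 2]) (use u Y in auto)
    qed
  qed (use U in simp)
  ultimately show ?thesis by (simp add: fm_fun_def)
qed

lemma forces_bij_graph_name:
  fixes a :: "'a \<Rightarrow> ('i, 'b::boolean_algebra) name"
  assumes U: "countable U" and a: "separated a U" and b: "separated b U"
  shows "forces (fm_bij (graph_name a b U) (hat (a ` U)) (hat (b ` U))) p"
proof -
  have "forces (ForallIn (hat (b ` U)) (\<lambda>v. ExistsIn (hat (a ` U)) (\<lambda>u. And (fm_app (graph_name a b U) u v)
            (Forall (\<lambda>w. Imp (fm_app (graph_name a b U) w v) (Eq w u)))))) p"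
  proof (subst forces_ForallIn_hat)
    show "extensional_fm (\<lambda>v. ExistsIn (hat (a ` U)) (\<lambda>u. And (fm_app (graph_name a b U) u v)
            (Forall (\<lambda>w. Imp (fm_app (graph_name a b U) w v) (Eq w u)))))"
      unfolding fm_defs[abs_def] by (intro extensional_fm_intros)
    show "\<forall>x\<in>b ` U. forces (ExistsIn (hat (a ` U)) (\<lambda>u. And (fm_app (graph_name a b U) u x)
            (Forall (\<lambda>w. Imp (fm_app (graph_name a b U) w x) (Eq w u))))) p"
    proof
      fix x assume "x \<in> b ` U"
      then obtain u where u: "u \<in> U" "x = b u" by blast
      have "forces_eq q w (a u)" if "forces_mem q (pair_name w x) (graph_name a b U)" for q w
        using that unfolding forces_mem_graph_name[OF U]
        by (intro forces_eq_densely, elim densely_mono) (use u separatedD[OF b] in blast)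
      then have "forces (And (fm_app (graph_name a b U) (a u) x)
            (Forall (\<lambda>w. Imp (fm_app (graph_name a b U) w x) (Eq w (a u))))) p"
        using u forces_mem_graph_nameI[OF U] by (simp add: forces_app forces_Imp)
      then show "forces (ExistsIn (hat (a ` U)) (\<lambda>u. And (fm_app (graph_name a b U) u x)
            (Forall (\<lambda>w. Imp (fm_app (graph_name a b U) w x) (Eq w u))))) p"
        by (rule forces_ExistsIn_hatI[where x="a u", rotated 2]) (use u U in auto)
    qed
  qed (use U in simp)
  with forces_fun_graph_name[OF U _ order_refl a] U show ?thesis
    by (simp add: fm_bij_def)
qed

section \<open>Natural numbers and nodes\<close>

lemma forces_mem_nat_name:
  "forces_mem p w (nat_name n :: ('i, 'b::boolean_algebra) name) \<longleftrightarrow>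
     densely (\<lambda>r. \<exists>k<n. forces_eq r w (nat_name k)) p"
  by (subst nat_name.simps) (simp add: forces_mem_hat Bex_def)

lemma forces_mem_nat_nameI:
  "k < n \<Longrightarrow> forces_mem p (nat_name k) (nat_name n :: ('i, 'b::boolean_algebra) name)"
  by (subst (2) nat_name.simps) (rule forces_mem_hatI, auto)

lemma forces_ForallIn_nat_name:
  assumes "extensional_fm (\<phi> :: ('i, 'b::boolean_algebra) name \<Rightarrow> _)"
  shows "forces (ForallIn (nat_name n) \<phi>) p \<longleftrightarrow> (\<forall>k<n. forces (\<phi> (nat_name k)) p)"
  by (subst nat_name.simps, subst forces_ForallIn_hat) (auto simp: assms)

text \<open>If \<open>m < n\<close> were identified, then \<open>m\<close> would be a member of
  itself, hence densely equal to some \<open>k < m\<close>, which the induction hypothesis for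
  \<open>k\<close> excludes.\<close>

lemma separated_nat_name: "separated (nat_name :: nat \<Rightarrow> ('i, 'b::boolean_algebra) name) U"
proof -
  have lt: "\<not> forces_eq r (nat_name m) (nat_name n :: ('i, 'b) name)" if "m < n" "r \<noteq> bot" for m n r
    using that
  proof (induction m arbitrary: n r rule: less_induct)
    case (less m)
    show ?case
    proof
      assume "forces_eq r (nat_name m) (nat_name n :: ('i, 'b) name)"
      then have "forces_mem r (nat_name m) (nat_name m :: ('i, 'b) name)"
        using forces_mem_nat_nameI[OF less(2)] by (blast intro: forces_mem_cong_right forces_eq_sym)
      then obtain t k where "t \<noteq> bot" "k < m" "forces_eq t (nat_name m) (nat_name k :: ('i, 'b) name)"
        unfolding forces_mem_nat_name by (rule denselyE[OF _ less(3)]) blast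
      with less(1) show False by (blast intro: forces_eq_sym)
    qed
  qed
  then show ?thesis
    unfolding separated_def by (metis forces_eq_sym linorder_neqE_nat)
qed

lemma forces_mem_nat_name_Suc:
  "forces_mem p w (nat_name (Suc n) :: ('i, 'b::boolean_algebra) name) \<longleftrightarrow>
     densely (\<lambda>r. forces_mem r w (nat_name n) \<or> forces_eq r w (nat_name n)) p"
proof
  assume "forces_mem p w (nat_name (Suc n) :: ('i, 'b) name)"
  then show "densely (\<lambda>r. forces_mem r w (nat_name n) \<or> forces_eq r w (nat_name n)) p"
    unfolding forces_mem_nat_name[of p]
    by (rule densely_mono)
      (metis forces_mem_cong_left forces_eq_sym forces_mem_nat_nameI less_Suc_eq)
next
  assume "densely (\<lambda>r. forces_mem r w (nat_name n) \<or> forces_eq r w (nat_name n)) p"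
  then show "forces_mem p w (nat_name (Suc n) :: ('i, 'b) name)"
    unfolding forces_mem_nat_name
  proof (rule densely_bind)
    fix r assume "densely (\<lambda>r. \<exists>k<n. forces_eq r w (nat_name k)) r \<or> forces_eq r w (nat_name n)"
    then show "densely (\<lambda>r. \<exists>k<Suc n. forces_eq r w (nat_name k)) r"
    proof
      assume "densely (\<lambda>r. \<exists>k<n. forces_eq r w (nat_name k)) r"
      then show ?thesis by (rule densely_mono) (use less_SucI in blast)
    next
      assume "forces_eq r w (nat_name n)"
      then show ?thesis by (intro denselyI) (blast intro: forces_eq_le)
    qed
  qed
qed

lemma forces_transitive_nat_name:
  "forces (fm_transitive (nat_name n :: ('i, 'b::boolean_algebra) name)) p"
proof -
  have ext: "extensional_fm (\<lambda>z. Mem z (nat_name n :: ('i, 'b) name))"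
    by (rule extensional_fm_intros)
  show ?thesis
    unfolding fm_transitive_def forces_ForallIn_nat_name[OF extensional_fms(6)]
    unfolding fm_subset_def forces_ForallIn_nat_name[OF ext]
    by (simp add: forces_mem_nat_nameI)
qed

lemma forces_zero_or_succ_nat_name:
  "forces (fm_zero_or_succ (nat_name n :: ('i, 'b::boolean_algebra) name)) p"
proof (cases n)
  case 0
  have "\<not> forces_mem q w (nat_name 0 :: ('i, 'b) name)" if "q \<noteq> bot" for q w
    using that unfolding forces_mem_nat_name by (auto elim: denselyE)
  then show ?thesis
    unfolding fm_zero_or_succ_def forces_Or 0 by (intro denselyI) auto
next
  case (Suc k)
  have "forces (Forall (\<lambda>w. Iff (Mem w (nat_name (Suc k) :: ('i, 'b) name))
      (Or (Mem w (nat_name k)) (Eq w (nat_name k))))) q" for q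
    by (rule iffD2[OF forces_defining[where \<tau>="nat_name (Suc k)"]])
      (auto simp: forces_Or forces_mem_nat_name_Suc forces_eq_refl)
  then show ?thesis
    unfolding fm_zero_or_succ_def forces_Or Suc by (intro denselyI disjI2 forces_ExistsI)
qed

lemma forces_nat_nat_name: "forces (fm_nat (nat_name n :: ('i, 'b::boolean_algebra) name)) p"
  by (simp add: fm_nat_def forces_ForallIn_nat_name extensional_fms
      forces_transitive_nat_name forces_zero_or_succ_nat_name)

text \<open>Transitivity of \<open>n\<close> puts the elements of \<open>y\<close> into
  \<open>n\<close>, so the clauses about all elements of \<open>n\<close> are inherited by
  \<open>y\<close>.\<close>

lemma forces_nat_mem:
  assumes "forces (fm_nat n) p" "forces_mem p y n"
  shows "forces (fm_nat y) p"
proof -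
  have tr: "forces (fm_transitive n) p" "forces (ForallIn n fm_transitive) p"
    "forces (ForallIn n fm_zero_or_succ) p"
    using assms(1) by (auto simp: fm_nat_def)
  have sub: "forces_mem q z n" if "q \<le> p" "forces_mem q z y" for q z
    using tr(1) assms(2) that unfolding fm_transitive_def forces_ForallIn forces_subset by blast
  show ?thesis
    unfolding fm_nat_def forces.simps
  proof (intro conjI)
    show "forces (fm_transitive y) p" "forces (fm_zero_or_succ y) p"
      using tr assms(2) unfolding forces_ForallIn by auto
    show "forces (ForallIn y fm_transitive) p" "forces (ForallIn y fm_zero_or_succ) p"
      using tr(2,3) sub unfolding forces_ForallIn by auto
  qed
qed

text \<open>Forcing adds no natural numbers. Induction on the name: where \<open>n\<close> is forced
  empty it is 0; where it is the successor of some \<open>y\<close>, the predecessor is decided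
  densely as some \<open>k\<close> by the induction hypothesis, and \<open>n\<close> is
  \<open>Suc k\<close>.\<close>

lemma forces_nat_decided:
  fixes n :: "('i, 'b::boolean_algebra) name"
  assumes "forces (fm_nat n) p"
  shows "densely (\<lambda>r. \<exists>k. forces_eq r n (nat_name k)) p"
  using assms
proof (induction n arbitrary: p rule: name_induct)
  case (1 n)
  have "forces (fm_zero_or_succ n) p" using 1(2) by (simp add: fm_nat_def)
  then show ?case unfolding fm_zero_or_succ_def forces_Or
  proof (rule densely_bind)
    fix r assume "r \<le> p" "forces (Forall (\<lambda>w. Neg (Mem w n))) r \<or>
      forces (Exists (\<lambda>y. Forall (\<lambda>w. Iff (Mem w n) (Or (Mem w y) (Eq w y))))) r"
    from this(2) show "densely (\<lambda>r. \<exists>k. forces_eq r n (nat_name k)) r"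
    proof
      assume empty: "forces (Forall (\<lambda>w. Neg (Mem w n))) r"
      have "forces_eq r n (nat_name 0)"
      proof (rule forces_eqI_ext)
        fix q \<pi> assume "q \<noteq> bot" "q \<le> r"
        with empty show "forces_mem q \<pi> n = forces_mem q \<pi> (nat_name 0)"
          unfolding forces_mem_nat_name[of q] by (auto elim: denselyE)
      qed
      then show ?thesis by (intro denselyI) (blast intro: forces_eq_le)
    next
      assume "forces (Exists (\<lambda>y. Forall (\<lambda>w. Iff (Mem w n) (Or (Mem w y) (Eq w y))))) r"
      then show ?thesis unfolding forces_Exists
      proof (rule densely_bind)
        fix t assume t: "t \<le> r" "\<exists>y. forces (Forall (\<lambda>w. Iff (Mem w n) (Or (Mem w y) (Eq w y)))) t"
        then obtain y where y: "\<And>q w. q \<le> t \<Longrightarrow>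
            forces_mem q w n \<longleftrightarrow> densely (\<lambda>r. forces_mem r w y \<or> forces_eq r w y) q"
          by (auto simp: forces_Iff forces_Or)
        have yn: "forces_mem t y n"
          unfolding y[OF order_refl] by (rule denselyI) (simp add: forces_eq_refl)
        have nat_y: "forces (fm_nat y) t"
          using forces_le[OF 1(2) order_trans[OF t(1) \<open>r \<le> p\<close>]] yn by (rule forces_nat_mem)
        \<comment> \<open>The name \<open>y\<close> need not occur in \<open>n\<close>, so the
          induction hypothesis is applied to an element \<pi> of \<open>n\<close> that is densely
          equal to it.\<close>
        from yn show "densely (\<lambda>r. \<exists>k. forces_eq r n (nat_name k)) t"
          unfolding forces_mem_iff
        proof (rule densely_bind)
          fix u assume u: "u \<le> t" "\<exists>(\<pi>, s)\<in>elems n. u \<le> s \<and> forces_eq u y \<pi>"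
          then obtain \<pi> s where \<pi>: "(\<pi>, s) \<in> elems n" "forces_eq u y \<pi>" by blast
          have "forces (fm_nat \<pi>) u"
            using extensional_fms(1) \<pi>(2) forces_le[OF nat_y u(1)] by (rule extensional_fmD)
          from 1(1)[OF \<pi>(1) this]
          show "densely (\<lambda>r. \<exists>k. forces_eq r n (nat_name k)) u"
          proof (rule densely_mono)
            fix v assume v: "v \<le> u" "\<exists>k. forces_eq v \<pi> (nat_name k)"
            then obtain k where "forces_eq v \<pi> (nat_name k)" by blast
            then have k: "forces_eq v y (nat_name k)"
              using forces_eq_le[OF \<pi>(2) v(1)] forces_eq_trans by blast
            have "forces_eq v n (nat_name (Suc k))"
            proof (rule forces_eqI_ext)
              fix q w assume q: "q \<le> v"
              have "densely (\<lambda>r. forces_mem r w y \<or> forces_eq r w y) q \<longleftrightarrow>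
                  densely (\<lambda>r. forces_mem r w (nat_name k) \<or> forces_eq r w (nat_name k)) q"
              proof (rule densely_cong)
                fix r assume "r \<le> q"
                show "(forces_mem r w y \<or> forces_eq r w y) \<longleftrightarrow>
                  (forces_mem r w (nat_name k) \<or> forces_eq r w (nat_name k))"
                  using forces_eq_le[OF k order_trans[OF \<open>r \<le> q\<close> q]]
                  by (metis forces_mem_cong_right forces_eq_trans forces_eq_sym)
              qed
              moreover have "q \<le> t" using q v(1) u(1) by (meson order_trans)
              ultimately show "forces_mem q w n = forces_mem q w (nat_name (Suc k))"
                by (simp add: y forces_mem_nat_name_Suc)
            qed
            then show "\<exists>k. forces_eq v n (nat_name k)" by blast
          qed
        qed
      qed
    qed
  qed
qed

text \<open>Since natural numbers of the extension are densely decided to be standard, the standard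
  ones name the \<omega> of the extension.\<close>

lemma forces_omega: "forces (fm_omega (hat (range nat_name) :: ('i, 'b::boolean_algebra) name)) p"
  unfolding fm_omega_def
proof (subst forces_defining[where \<tau>="hat (range nat_name)"])
  fix q and w :: "('i, 'b) name"
  show "forces_mem q w (hat (range nat_name)) = forces (fm_nat w) q"
  proof
    assume "forces_mem q w (hat (range nat_name))"
    then have "densely (\<lambda>r. \<exists>k. forces_eq r w (nat_name k)) q"
      by (simp add: forces_mem_hat)
    then have "densely (forces (fm_nat w)) q"
      by (rule densely_mono)
        (metis extensional_fmD extensional_fms(1) forces_eq_sym forces_nat_nat_name)
    then show "forces (fm_nat w) q" by (rule forces_densely)
  next
    assume "forces (fm_nat w) q"
    then show "forces_mem q w (hat (range nat_name))"
      by (simp add: forces_mem_hat forces_nat_decided)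
  qed
qed (rule forces_eq_refl)

section \<open>Names of nodes and of finite sets of nodes\<close>

lemma forces_node_node_name: "forces (fm_node (node_name s :: ('i, 'b::boolean_algebra) name)) p"
proof -
  let ?\<omega> = "hat (range nat_name) :: ('i, 'b) name"
  have "forces (fm_fun (graph_name nat_name (\<lambda>i. nat_name (s ! i)) {..<length s})
      (hat (nat_name ` {..<length s})) ?\<omega>) p"
    by (rule forces_fun_graph_name) (auto intro: separated_nat_name)
  then have "forces (fm_fun (node_name s) (nat_name (length s)) ?\<omega>) p"
    by (simp add: node_name_def graph_name_def nat_name.simps[symmetric])
  then have "forces (ExistsIn ?\<omega> (\<lambda>n. fm_fun (node_name s) n ?\<omega>)) p"
    by (rule forces_ExistsIn_hatI[rotated 2]) auto
  then show ?thesis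
    unfolding fm_node_def by (intro forces_ExistsI[where x="?\<omega>"]) (simp add: forces_omega)
qed

text \<open>Inclusion puts the pair of \<open>i\<close> and \<open>s ! i\<close> into the name of
  \<open>t\<close>. Injectivity of pairs and separation of the numerals then identify it with an
  entry of \<open>t\<close> at the same position.\<close>

lemma forces_subset_node_name:
  assumes "forces (fm_subset (node_name s :: ('i, 'b::boolean_algebra) name) (node_name t)) p" "p \<noteq> bot"
  shows "prefix s t"
proof -
  have "i < length t \<and> s ! i = t ! i" if "i < length s" for i
  proof -
    have "forces_mem p (pair_name (nat_name i) (nat_name (s ! i))) (node_name s :: ('i, 'b) name)"
      unfolding node_name_def by (rule forces_mem_hatI) (use that in auto)
    then have "forces_mem p (pair_name (nat_name i) (nat_name (s ! i))) (node_name t :: ('i, 'b) name)"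
      using assms(1) unfolding forces_subset by blast
    then have "densely (\<lambda>r. \<exists>j\<in>{..<length t}. forces_eq r (nat_name i) (nat_name j :: ('i, 'b) name) \<and>
        forces_eq r (nat_name (s ! i)) (nat_name (t ! j) :: ('i, 'b) name)) p"
      unfolding node_name_def graph_name_def[symmetric] by (simp add: forces_mem_graph_name)
    then obtain r j where "r \<noteq> bot" "j < length t" "forces_eq r (nat_name i) (nat_name j :: ('i, 'b) name)"
        "forces_eq r (nat_name (s ! i)) (nat_name (t ! j) :: ('i, 'b) name)"
      by (rule denselyE[OF _ assms(2)]) blast
    then show ?thesis using separatedD[OF separated_nat_name[of UNIV]] by blast
  qed
  moreover from this have "length s \<le> length t" by (metis leI less_irrefl)
  ultimately have "s = take (length s) t"
    by (intro nth_equalityI) auto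
  then show ?thesis by (metis take_is_prefix)
qed

lemma separated_node_name: "separated (node_name :: nat list \<Rightarrow> ('i, 'b::boolean_algebra) name) U"
  unfolding separated_def
proof (intro ballI allI impI)
  fix s t and r :: 'b
  assume r: "r \<noteq> bot" "forces_eq r (node_name s :: ('i, 'b) name) (node_name t)"
  then have "forces (fm_subset (node_name s :: ('i, 'b) name) (node_name t)) r"
    "forces (fm_subset (node_name t :: ('i, 'b) name) (node_name s)) r"
    unfolding forces_subset by (meson forces_eq_le forces_mem_cong_right forces_eq_sym)+
  then show "s = t"
    using r(1) forces_subset_node_name prefix_order.antisym by blast
qed

text \<open>A ground model bijection between \<open>U\<close> and the numbers below
  \<open>card U\<close> becomes a graph name for a bijection in the extension.\<close>

lemma forces_finite_hat:
  fixes a :: "'a \<Rightarrow> ('i, 'b::boolean_algebra) name"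
  assumes "finite U" "separated a U"
  shows "forces (fm_finite (hat (a ` U))) p"
proof -
  obtain g where g: "bij_betw g U {..<card U}"
    using ex_bij_betw_finite_nat[OF assms(1)] by (auto simp: lessThan_atLeast0)
  have "separated (\<lambda>u. nat_name (g u) :: ('i, 'b) name) U"
    unfolding separated_def
    using separatedD[OF separated_nat_name[of UNIV]] g by (meson UNIV_I bij_betw_imp_inj_on inj_onD)
  then have "forces (fm_bij (graph_name a (\<lambda>u. nat_name (g u)) U) (hat (a ` U)) (hat ((\<lambda>u. nat_name (g u)) ` U))) p"
    using assms by (intro forces_bij_graph_name) (auto intro: countable_finite)
  moreover have "hat ((\<lambda>u. nat_name (g u)) ` U) = (nat_name (card U) :: ('i, 'b) name)"
    using g by (subst nat_name.simps) (auto simp: bij_betw_def image_image[symmetric])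
  ultimately show ?thesis
    unfolding fm_finite_def
    by (intro forces_ExistsI[where x="nat_name (card U)"]) (auto simp: forces_nat_nat_name intro: forces_ExistsI)
qed

lemma forces_mem_node_set_name:
  "forces_mem p w (node_set_name C :: ('i, 'b::boolean_algebra) name) \<longleftrightarrow>
     densely (\<lambda>r. \<exists>s\<in>C. forces_eq r w (node_name s)) p"
  unfolding node_set_name_def by (simp add: forces_mem_hat)

lemma forces_mem_node_set_nameI:
  "s \<in> C \<Longrightarrow> forces_mem p (node_name s) (node_set_name C :: ('i, 'b::boolean_algebra) name)"
  unfolding node_set_name_def by (rule forces_mem_hatI) auto

text \<open>The existential quantifier need only be witnessed densely, so the finite set may vary
  with the extension of the condition.\<close>

lemma forces_almost_disjointI:
  fixes A b :: "('i, 'b::boolean_algebra) name"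
  assumes "\<And>q. q \<noteq> bot \<Longrightarrow> q \<le> p \<Longrightarrow>
    \<exists>r C. r \<noteq> bot \<and> r \<le> q \<and> finite C \<and> forces (fm_inter (node_set_name C) A b) r"
  shows "forces (fm_almost_disjoint A b) p"
  unfolding fm_almost_disjoint_def forces_Exists densely_def
proof (intro allI impI)
  fix q assume "q \<noteq> bot \<and> q \<le> p"
  then obtain r C where r: "r \<noteq> bot" "r \<le> q" and C: "finite C" "forces (fm_inter (node_set_name C) A b) r"
    using assms by blast
  have "forces (fm_finite (node_set_name C :: ('i, 'b) name)) r"
    unfolding node_set_name_def using C(1) separated_node_name by (rule forces_finite_hat)
  with r C(2) show "\<exists>r. r \<noteq> bot \<and> r \<le> q \<and> (\<exists>x. forces (And (fm_inter x A b) (fm_finite x)) r)"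
    by auto
qed

section \<open>Subsets of the tree given by Boolean values\<close>

context
  fixes A :: "('i, 'b::boolean_algebra) name" and e :: "nat list \<Rightarrow> 'b"
  assumes elems_A: "elems A = range (\<lambda>s. (node_name s, e s))"
begin

text \<open>The Boolean value of \<open>s\<close> belonging to \<open>A\<close> is exactly
  \<open>e s\<close>. If \<open>p\<close> were not below it, the nonzero part of \<open>p\<close>
  outside \<open>e s\<close> would force membership, and some extension would lie below
  \<open>e t\<close> with \<open>t\<close> named like \<open>s\<close>; separation gives
  \<open>t = s\<close>, a contradiction.\<close>

lemma forces_mem_A: "forces_mem p (node_name s) A \<longleftrightarrow> p \<le> e s"
proof
  assume mem: "forces_mem p (node_name s) A"
  show "p \<le> e s"
  proof (rule ccontr)
    assume "\<not> p \<le> e s"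
    then have "inf p (- e s) \<noteq> bot" by (simp add: inf_shunt)
    moreover have "forces_mem (inf p (- e s)) (node_name s) A"
      using mem by (rule forces_mem_le) simp
    ultimately obtain r t where r: "r \<noteq> bot" "r \<le> inf p (- e s)" "r \<le> e t" "forces_eq r (node_name s) (node_name t :: ('i, 'b) name)"
      unfolding forces_mem_iff elems_A by (elim denselyE) auto
    then have "s = t" using separatedD[OF separated_node_name[of UNIV]] by blast
    have "r \<le> inf (e s) (- e s)"
      by (rule le_infI) (use r \<open>s = t\<close> in auto)
    with r(1) show False by (simp add: bot_unique)
  qed
next
  assume "p \<le> e s"
  then show "forces_mem p (node_name s) A"
    by (intro forces_mem_elems[where s="e s"]) (simp_all add: elems_A)
qed

lemma forces_mem_A_iff:
  "forces_mem p w A \<longleftrightarrow> densely (\<lambda>r. \<exists>s. r \<le> e s \<and> forces_eq r w (node_name s)) p"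
  unfolding forces_mem_iff elems_A by simp

text \<open>Every member of \<open>A\<close> is densely equal to the name of a ground model node, so
  to identify the intersection it suffices to decide it node by node.\<close>

lemma forces_inter_A:
  assumes C: "\<And>s. s \<in> C \<Longrightarrow> p \<le> e s \<and> forces_mem p (node_name s) b"
    and not_C: "\<And>s q. s \<notin> C \<Longrightarrow> q \<noteq> bot \<Longrightarrow> q \<le> p \<Longrightarrow> q \<le> e s \<Longrightarrow> \<not> forces_mem q (node_name s) b"
  shows "forces (fm_inter (node_set_name C) A b) p"
  unfolding fm_inter_def forces.simps(5) forces_Iff
proof (intro allI impI)
  fix w :: "('i, 'b) name" and q assume q: "q \<le> p"
  show "forces (Mem w (node_set_name C)) q = forces (And (Mem w A) (Mem w b)) q"
  proof
    assume "forces (Mem w (node_set_name C)) q"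
    then have "densely (\<lambda>r. forces_mem r w A \<and> forces_mem r w b) q"
      unfolding forces.simps forces_mem_node_set_name
    proof (rule densely_mono)
      fix r assume r: "r \<le> q" "\<exists>s\<in>C. forces_eq r w (node_name s)"
      then obtain s where s: "s \<in> C" "forces_eq r (node_name s) w" by (blast intro: forces_eq_sym)
      have "r \<le> p" using r(1) q by (rule order_trans)
      then have "forces_mem r (node_name s) A" "forces_mem r (node_name s) b"
        using C[OF s(1)] by (auto simp: forces_mem_A intro: order_trans forces_mem_le)
      with s(2) show "forces_mem r w A \<and> forces_mem r w b"
        by (blast intro: forces_mem_cong_left)
    qed
    then have "densely (\<lambda>r. forces_mem r w A) q" "densely (\<lambda>r. forces_mem r w b) q"
      by (auto elim: densely_mono)
    then show "forces (And (Mem w A) (Mem w b)) q"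
      by (simp add: forces_mem_densely)
  next
    assume "forces (And (Mem w A) (Mem w b)) q"
    then have A: "forces_mem q w A" and b: "forces_mem q w b" by auto
    from A have "densely (\<lambda>r. \<exists>s\<in>C. forces_eq r w (node_name s)) q"
      unfolding forces_mem_A_iff
    proof (rule densely_mono)
      fix r assume r: "r \<noteq> bot" "r \<le> q" "\<exists>s. r \<le> e s \<and> forces_eq r w (node_name s)"
      then obtain s where s: "r \<le> e s" "forces_eq r w (node_name s)" by blast
      have "forces_mem r (node_name s) b"
        using s(2) forces_mem_le[OF b r(2)] by (rule forces_mem_cong_left)
      then have "s \<in> C" using not_C[OF _ r(1) order_trans[OF r(2) q] s(1)] by blast
      with s show "\<exists>s\<in>C. forces_eq r w (node_name s)" by blast
    qed
    then show "forces (Mem w (node_set_name C)) q"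
      by (simp add: forces_mem_node_set_name)
  qed
qed

text \<open>If some extension of \<open>q\<close> puts a node \<open>s\<close> into both
  \<open>A\<close> and \<open>b\<close>, then below it the intersection is \<open>{s}\<close>:
  another common node would densely be comparable with \<open>s\<close>, against the antichain
  condition. Otherwise the intersection is empty below \<open>q\<close>. This treats every chain of
  the extension, new branches included.\<close>

lemma forces_almost_disjoint_chain:
  assumes antichain: "\<And>s t. prefix s t \<Longrightarrow> s \<noteq> t \<Longrightarrow> inf (e s) (e t) = bot"
    and chain: "forces (fm_chain b) p"
  shows "forces (fm_almost_disjoint A b) p"
proof (rule forces_almost_disjointI)
  fix q assume q: "q \<noteq> bot" "q \<le> p"
  show "\<exists>r C. r \<noteq> bot \<and> r \<le> q \<and> finite C \<and> forces (fm_inter (node_set_name C) A b) r"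
  proof (cases "\<exists>r s. r \<noteq> bot \<and> r \<le> q \<and> r \<le> e s \<and> forces_mem r (node_name s) b")
    case True
    then obtain r s where r: "r \<noteq> bot" "r \<le> q" "r \<le> e s" "forces_mem r (node_name s) b" by blast
    have "t = s" if t: "t' \<noteq> bot" "t' \<le> r" "t' \<le> e t" "forces_mem t' (node_name t) b" for t t'
    proof -
      have "t' \<le> p" using t(2) r(2) q(2) by (meson order_trans)
      with chain have "forces (fm_chain b) t'" by (rule forces_le)
      then have "\<forall>x. \<forall>q\<le>t'. forces_mem q x b \<longrightarrow> (\<forall>y. \<forall>q'\<le>q. forces_mem q' y b \<longrightarrow>
          forces (Or (fm_subset x y) (fm_subset y x)) q')"
        by (simp add: fm_chain_def forces_ForallIn)
      then have "forces (Or (fm_subset (node_name s :: ('i, 'b) name) (node_name t))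
          (fm_subset (node_name t) (node_name s))) t'"
        using t(4) forces_mem_le[OF r(4) t(2)] by (meson order_refl)
      then obtain u where u: "u \<noteq> bot" "u \<le> t'" "prefix s t \<or> prefix t s"
        unfolding forces_Or by (rule denselyE[OF _ t(1)]) (use forces_subset_node_name in blast)
      have "u \<le> e s" "u \<le> e t" using u(2) t(2,3) r(3) by (meson order_trans)+
      then have "u \<le> inf (e s) (e t)" "u \<le> inf (e t) (e s)" by simp_all
      with u antichain[of s t] antichain[of t s] show ?thesis by (metis bot_unique)
    qed
    then have "\<not> forces_mem t' (node_name t) b" if "t \<notin> {s}" "t' \<noteq> bot" "t' \<le> r" "t' \<le> e t" for t t'
      using that by blast
    moreover have "r \<le> e t \<and> forces_mem r (node_name t) b" if "t \<in> {s}" for t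
      using that r by simp
    ultimately have "forces (fm_inter (node_set_name {s}) A b) r"
      by (intro forces_inter_A)
    with r show ?thesis by blast
  next
    case False
    then have "forces (fm_inter (node_set_name {}) A b) q"
      by (intro forces_inter_A) auto
    with q show ?thesis by blast
  qed
qed

lemma forces_almost_disjoint_node_set_name:
  assumes "\<And>q. q \<noteq> bot \<Longrightarrow> \<exists>r C. r \<noteq> bot \<and> r \<le> q \<and> finite C \<and> C \<subseteq> B \<and>
      (\<forall>s\<in>C. r \<le> e s) \<and> (\<forall>s\<in>B - C. inf r (e s) = bot)"
  shows "forces (fm_almost_disjoint A (node_set_name B)) p"
proof (rule forces_almost_disjointI)
  fix q :: 'b assume "q \<noteq> bot"
  from assms[OF this] obtain r C where r: "r \<noteq> bot" "r \<le> q"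
    and C: "finite C" "C \<subseteq> B" "\<forall>s\<in>C. r \<le> e s" "\<forall>s\<in>B - C. inf r (e s) = bot" by blast
  have "forces (fm_inter (node_set_name C) A (node_set_name B)) r"
  proof (rule forces_inter_A)
    fix s assume "s \<in> C"
    with C show "r \<le> e s \<and> forces_mem r (node_name s) (node_set_name B :: ('i, 'b) name)"
      by (auto intro: forces_mem_node_set_nameI)
  next
    fix s t assume t: "s \<notin> C" "t \<noteq> bot" "t \<le> r" "t \<le> e s"
    show "\<not> forces_mem t (node_name s) (node_set_name B :: ('i, 'b) name)"
    proof
      assume "forces_mem t (node_name s) (node_set_name B :: ('i, 'b) name)"
      then obtain u s' where "u \<noteq> bot" "s' \<in> B" "forces_eq u (node_name s) (node_name s' :: ('i, 'b) name)"
        unfolding forces_mem_node_set_name by (rule denselyE[OF _ t(2)]) blast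
      then have "s \<in> B" using separatedD[OF separated_node_name[of UNIV]] by blast
      with C(4) t(1) have "inf r (e s) = bot" by blast
      moreover have "t \<le> inf r (e s)" using t(3,4) by (rule le_infI)
      ultimately show False using t(2) by (simp add: bot_unique)
    qed
  qed
  with r C(1) show "\<exists>r C. r \<noteq> bot \<and> r \<le> q \<and> finite C \<and> forces (fm_inter (node_set_name C) A (node_set_name B)) r"
    by blast
qed

lemma forces_node_A: "forces (ForallIn A fm_node) p"
  unfolding forces_ForallIn_elems[OF extensional_fms(2)] elems_A
  by (auto intro: forces_node_node_name)

text \<open>The condition is strengthened once for each element of \<open>C\<close>; by
  \<open>mono\<close>, the values already decided survive.\<close>

lemma finitely_many_values:
  assumes "finite C" "q \<noteq> bot" "\<And>s. s \<in> C \<Longrightarrow> densely (\<lambda>r. \<exists>j<k. P s j r) q"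
    and mono: "\<And>s j r r'. P s j r \<Longrightarrow> r' \<le> r \<Longrightarrow> P s j r'"
  shows "\<exists>r g. r \<noteq> bot \<and> r \<le> q \<and> (\<forall>s\<in>C. g s < (k::nat) \<and> P s (g s) (r::'b))"
  using assms(1,3)
proof (induction C)
  case empty
  then show ?case using assms(2) by blast
next
  case (insert s C)
  then obtain r g where r: "r \<noteq> bot" "r \<le> q" "\<forall>s\<in>C. g s < k \<and> P s (g s) r" by auto
  have "densely (\<lambda>r. \<exists>j<k. P s j r) r"
    using insert(4)[of s] densely_le r(2) by blast
  then obtain t j where t: "t \<noteq> bot" "t \<le> r" "j < k" "P s j t"
    by (rule denselyE[OF _ r(1)]) blast
  have "\<forall>s'\<in>insert s C. (g(s := j)) s' < k \<and> P s' ((g(s := j)) s') t"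
    using t r(3) mono[OF _ t(2)] insert(2) by auto
  moreover have "t \<le> q" using t(2) r(2) by (rule order_trans)
  ultimately show ?case using t(1) by blast
qed

text \<open>Given a forced bijection \<open>f\<close> of \<open>A\<close> with a natural number,
  decide that number as \<open>k\<close>, then decide more than \<open>k\<close> nodes of
  \<open>A\<close> and their values under \<open>f\<close>. Two distinct nodes share a value,
  against injectivity.\<close>

lemma forces_infinite_A:
  assumes large: "\<And>q k. q \<noteq> bot \<Longrightarrow> \<exists>r C. r \<noteq> bot \<and> r \<le> q \<and> finite C \<and> card C = k \<and> (\<forall>s\<in>C. r \<le> e s)"
  shows "forces (Neg (fm_finite A)) p"
  unfolding forces.simps
proof (intro allI impI notI)
  fix q assume q: "q \<noteq> bot \<and> q \<le> p" "forces (fm_finite A) q"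
  then obtain q1 n where q1: "q1 \<noteq> bot" "forces (fm_nat n) q1" "forces (Exists (\<lambda>f. fm_bij f A n)) q1"
    unfolding fm_finite_def forces_Exists[of _ q] by (auto elim!: denselyE)
  obtain q2 k where q2: "q2 \<noteq> bot" "q2 \<le> q1" "forces_eq q2 n (nat_name k)"
    using forces_nat_decided[OF q1(2)] q1(1) by (rule denselyE) blast
  obtain q3 f where q3: "q3 \<noteq> bot" "q3 \<le> q2" "forces (fm_bij f A n) q3"
    using forces_le[OF q1(3) q2(2)] q2(1) unfolding forces_Exists by (rule denselyE) blast
  \<comment> \<open>One node more than \<open>k\<close>, for the pigeonhole principle.\<close>
  obtain q4 C where q4: "q4 \<noteq> bot" "q4 \<le> q3" and C: "finite C" "card C = Suc k" "\<forall>s\<in>C. q4 \<le> e s"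
    using large[OF q3(1)] by blast
  have n: "forces_eq q4 n (nat_name k)"
    using q2(3) q3(2) q4(2) by (meson forces_eq_le)
  have bij: "forces (fm_bij f A n) q4" using q3(3) q4(2) by (rule forces_le)
  have "densely (\<lambda>r. \<exists>j<k. forces_mem r (pair_name (node_name s) (nat_name j)) f) q4" if "s \<in> C" for s
  proof -
    have "forces_mem q4 (node_name s) A" using C(3) that by (simp add: forces_mem_A)
    then have "forces (ExistsIn n (\<lambda>v. And (fm_app f (node_name s) v)
        (Forall (\<lambda>w. Imp (fm_app f (node_name s) w) (Eq w v))))) q4"
      using bij unfolding fm_bij_def fm_fun_def forces.simps forces_ForallIn by blast
    then show ?thesis unfolding forces_ExistsIn
    proof (rule densely_bind)
      fix r assume r: "r \<le> q4" "\<exists>v. forces_mem r v n \<and> forces (And (fm_app f (node_name s) v)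
          (Forall (\<lambda>w. Imp (fm_app f (node_name s) w) (Eq w v)))) r"
      then obtain v where v: "forces_mem r v n" "forces_mem r (pair_name (node_name s) v) f"
        by (auto simp: forces_app)
      have "forces_mem r v (nat_name k)"
        using forces_eq_le[OF n r(1)] v(1) by (rule forces_mem_cong_right)
      then show "densely (\<lambda>r. \<exists>j<k. forces_mem r (pair_name (node_name s) (nat_name j)) f) r"
        unfolding forces_mem_nat_name
      proof (rule densely_mono)
        fix t assume t: "t \<le> r" "\<exists>j<k. forces_eq t v (nat_name j)"
        then obtain j where j: "j < k" "forces_eq t v (nat_name j)" by blast
        then have "forces_eq t (pair_name (node_name s) v) (pair_name (node_name s) (nat_name j))"
          by (simp add: forces_eq_pair_name forces_eq_refl)
        then have "forces_mem t (pair_name (node_name s) (nat_name j)) f"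
          using forces_mem_le[OF v(2) t(1)] by (rule forces_mem_cong_left)
        with j show "\<exists>j<k. forces_mem t (pair_name (node_name s) (nat_name j)) f" by blast
      qed
    qed
  qed
  then have "\<exists>r g. r \<noteq> bot \<and> r \<le> q4 \<and>
      (\<forall>s\<in>C. g s < k \<and> forces_mem r (pair_name (node_name s) (nat_name (g s))) f)"
    by (rule finitely_many_values[OF C(1) q4(1)]) (auto intro: forces_mem_le)
  then obtain q5 g where q5: "q5 \<noteq> bot" "q5 \<le> q4"
    and g: "\<forall>s\<in>C. g s < k \<and> forces_mem q5 (pair_name (node_name s) (nat_name (g s))) f" by blast
  have "card (g ` C) < card C"
    using g C(2) card_mono[of "{..<k}" "g ` C"] by (simp add: image_subset_iff)
  then have "\<not> inj_on g C" by (rule pigeonhole)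
  then obtain s t where st: "s \<in> C" "t \<in> C" "s \<noteq> t" "g s = g t" by (auto simp: inj_on_def)
  \<comment> \<open>Injectivity is stated in \<open>fm_bij\<close> as uniqueness of preimages for
    elements of the codomain, so the common value must first be placed in \<open>n\<close>.\<close>
  have "forces_mem q5 (nat_name (g s)) n"
    using forces_eq_sym[OF forces_eq_le[OF n q5(2)]] forces_mem_nat_nameI st(1) g
    by (blast intro: forces_mem_cong_right)
  then have "forces (ExistsIn A (\<lambda>u. And (fm_app f u (nat_name (g s)))
      (Forall (\<lambda>w. Imp (fm_app f w (nat_name (g s))) (Eq w u))))) q5"
    using forces_le[OF bij q5(2)] unfolding fm_bij_def forces.simps forces_ForallIn by blast
  then obtain q6 u where q6: "q6 \<noteq> bot" "q6 \<le> q5"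
    "\<And>w. forces_mem q6 (pair_name w (nat_name (g s))) f \<Longrightarrow> forces_eq q6 w u"
    unfolding forces_ExistsIn
    by (rule denselyE[OF _ q5(1)]) (auto simp: forces_app forces_Imp)
  have "forces_eq q6 (node_name s) u" "forces_eq q6 (node_name t) u"
    using q6(3) forces_mem_le[OF _ q6(2)] g st by metis+
  then have "forces_eq q6 (node_name s) (node_name t :: ('i, 'b) name)"
    by (blast intro: forces_eq_trans forces_eq_sym)
  with q6(1) st(3) show False using separatedD[OF separated_node_name[of UNIV]] by blast
qed

text \<open>Everything about forcing is reduced here to conditions on the Boolean values
  \<open>e\<close>, which are left to measure theory. A family may be uncountable, so the elements
  of its name are described by a hypothesis of their own.\<close>

lemma not_maximal_if:
  fixes F :: "nat list set set"
  assumes F: "elems (family_name F :: ('i, 'b) name) = (\<lambda>x. (x, top)) ` node_set_name ` F"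
    and antichain: "\<And>s t. prefix s t \<Longrightarrow> s \<noteq> t \<Longrightarrow> inf (e s) (e t) = bot"
    and large: "\<And>q k. q \<noteq> bot \<Longrightarrow>
      \<exists>r C. r \<noteq> bot \<and> r \<le> q \<and> finite C \<and> card C = k \<and> (\<forall>s\<in>C. r \<le> e s)"
    and almost_disjoint: "\<And>B q. B \<in> F \<Longrightarrow> q \<noteq> bot \<Longrightarrow>
      \<exists>r C. r \<noteq> bot \<and> r \<le> q \<and> finite C \<and> C \<subseteq> B \<and>
        (\<forall>s\<in>C. r \<le> e s) \<and> (\<forall>s\<in>B - C. inf r (e s) = bot)"
  shows "holds_in_extension (Neg (fm_maximal (family_name F :: ('i, 'b) name)))"
proof -
  have "forces (fm_off_branch A) p" for p
    unfolding fm_off_branch_def forces.simps(4,5) forces_Imp fm_branch_def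
    using forces_node_A forces_infinite_A[OF large] forces_almost_disjoint_chain[OF antichain]
    by blast
  moreover have "forces (ForallIn (family_name F) (\<lambda>B. fm_almost_disjoint A B)) p" for p
    unfolding forces_ForallIn_elems[OF extensional_fms(5)] F
    using forces_almost_disjoint_node_set_name[OF almost_disjoint] by auto
  ultimately have "forces (And (fm_off_branch A) (ForallIn (family_name F) (\<lambda>B. fm_almost_disjoint A B))) p" for p
    by simp
  then have "forces (Exists (\<lambda>A. And (fm_off_branch A) (ForallIn (family_name F :: ('i, 'b) name) (\<lambda>B. fm_almost_disjoint A B)))) p" for p
    by (rule forces_ExistsI)
  then show ?thesis
    unfolding holds_in_extension_def fm_maximal_def forces.simps by blast
qed

end

end

section \<open>The comb\<close>

definition path :: "(nat \<Rightarrow> bool) \<Rightarrow> nat \<Rightarrow> nat list" where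
  "path x n = map (\<lambda>i. of_bool (x i)) [0..<n]"

definition comb_node :: "(nat \<Rightarrow> bool) \<Rightarrow> nat \<Rightarrow> nat list" where
  "comb_node x n = path x n @ [of_bool (\<not> x n)]"

definition comb :: "(nat \<Rightarrow> bool) \<Rightarrow> nat list set" where
  "comb x = range (comb_node x)"

text \<open>The symmetry of Cantor space that exchanges the node of \<open>x\<close> at level
  \<open>n + 1\<close> with the comb node leaving \<open>x\<close> there.\<close>

definition flip :: "nat \<Rightarrow> (nat \<Rightarrow> bool) \<Rightarrow> nat \<Rightarrow> bool" where
  "flip n x = x(n := \<not> x n)"

lemma length_path [simp]: "length (path x n) = n"
  by (simp add: path_def)

lemma length_comb_node [simp]: "length (comb_node x n) = Suc n"
  by (simp add: comb_node_def)

lemma path_Suc: "path x (Suc n) = path x n @ [of_bool (x n)]"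
  by (simp add: path_def)

text \<open>For \<open>m < n\<close> the two nodes differ at position \<open>m\<close>: the shorter
  one has just left \<open>x\<close>, the longer one still follows it.\<close>

lemma prefix_comb_node_iff: "prefix (comb_node x m) (comb_node x n) \<longleftrightarrow> m = n"
proof
  assume p: "prefix (comb_node x m) (comb_node x n)"
  then have le: "m \<le> n" by (auto dest: prefix_length_le)
  have "comb_node x n ! m = comb_node x m ! m"
    using p by (auto simp: prefix_def nth_append)
  then show "m = n"
    using le by (cases "m < n"; cases "x m") (auto simp: comb_node_def nth_append path_def)
qed simp

lemma inj_comb_node: "inj (comb_node x)"
  by (rule injI) (metis length_comb_node nat.inject)

lemma infinite_comb: "infinite (comb x)"
  unfolding comb_def by (rule range_inj_infinite) (rule inj_comb_node)

lemma comb_antichain: "s \<in> comb x \<Longrightarrow> t \<in> comb x \<Longrightarrow> prefix s t \<Longrightarrow> s = t"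
  by (auto simp: comb_def prefix_comb_node_iff)

lemma path_cong: "(\<And>i. i < n \<Longrightarrow> x i = y i) \<Longrightarrow> path x n = path y n"
  by (simp add: path_def)

lemma path_flip: "k \<le> n \<Longrightarrow> path (flip n x) k = path x k"
  by (rule path_cong) (simp add: flip_def)

lemma comb_node_flip: "k < n \<Longrightarrow> comb_node (flip n x) k = comb_node x k"
  by (simp add: comb_node_def path_flip) (simp add: flip_def)

lemma path_Suc_flip: "path (flip n x) (Suc n) = comb_node x n"
  by (simp add: comb_node_def path_Suc path_flip) (simp add: flip_def)

lemma comb_node_flip_same: "comb_node (flip n x) n = path x (Suc n)"
  by (simp add: comb_node_def path_Suc path_flip) (simp add: flip_def)

text \<open>A chain contains at most one node of each length, and the path already supplies one of
  every length, so no chain properly extends it.\<close>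

lemma branch_path: "branch (range (path x))"
proof -
  have mono: "prefix (path x m) (path x n)" if "m \<le> n" for m n
    using that by (induction n rule: dec_induct) (auto simp: path_Suc intro: prefix_order.trans)
  have chain: "pred_on.chain UNIV strict_prefix (range (path x))"
    unfolding pred_on.chain_def
  proof (intro conjI ballI, simp)
    fix s t assume "s \<in> range (path x)" "t \<in> range (path x)"
    then obtain m n where "s = path x m" "t = path x n" by auto
    then show "strict_prefix\<^sup>=\<^sup>= s t \<or> strict_prefix\<^sup>=\<^sup>= t s"
      using mono[of m n] mono[of n m] by (cases "m \<le> n") auto
  qed
  have "t \<in> range (path x)" if C: "pred_on.chain UNIV strict_prefix C" "range (path x) \<subseteq> C" "t \<in> C" for C t
  proof -
    have "path x (length t) \<in> C" using that by auto
    then have "strict_prefix\<^sup>=\<^sup>= t (path x (length t)) \<or> strict_prefix\<^sup>=\<^sup>= (path x (length t)) t"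
      using C unfolding pred_on.chain_def by blast
    then have "t = path x (length t)"
      by (auto dest: prefix_length_less)
    then show ?thesis by (rule range_eqI)
  qed
  with chain show ?thesis
    unfolding pred_on.maxchain_def by blast
qed

section \<open>Almost every comb is almost disjoint from a given off-branch set\<close>

lemma coin_component [measurable]: "(\<lambda>x. x i) \<in> measurable coin (count_space UNIV)"
proof -
  have "(\<lambda>x. x i) \<in> measurable coin (measure_pmf (bernoulli_pmf (1/2)))"
    unfolding coin_def by (rule measurable_component_singleton) simp
  then show ?thesis by simp
qed

lemma flip_measurable [measurable]: "flip n \<in> measurable coin coin"
proof -
  have "(\<lambda>x. flip n x i) \<in> measurable coin (count_space UNIV)" for i
    unfolding flip_def by (cases "i = n") simp_all
  then have "(\<lambda>x. flip n x i) \<in> measurable coin (measure_pmf (bernoulli_pmf (1/2)))" for i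
    by simp
  then have "(\<lambda>x. \<lambda>i\<in>UNIV. flip n x i) \<in> measurable coin coin"
    unfolding coin_def by (intro measurable_restrict) (auto simp: coin_def)
  then show ?thesis by (simp add: restrict_def)
qed

text \<open>Measurable for arbitrary \<open>B\<close>: there are only countably many nodes, and each
  of them restricts only finitely many coordinates.\<close>

lemma pred_path [measurable]: "Measurable.pred coin (\<lambda>x. path x n \<in> B)"
proof -
  have eq: "path x n = t \<longleftrightarrow> length t = n \<and> (\<forall>i\<in>{..<n}. t ! i = of_bool (x i))" for x t
    by (auto simp: list_eq_iff_nth_eq path_def)
  have "Measurable.pred coin (\<lambda>x. \<exists>t\<in>B. path x n = t)"
    unfolding eq by measurable
  then show ?thesis by simp
qed

lemma pred_comb_node [measurable]: "Measurable.pred coin (\<lambda>x. comb_node x n \<in> B)"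
proof -
  have "Measurable.pred coin (\<lambda>x. path (flip n x) (Suc n) \<in> B)"
    by (rule measurable_compose[OF flip_measurable pred_path])
  then show ?thesis unfolding path_Suc_flip .
qed

text \<open>The product measure is determined by its values on finite-dimensional cylinders. The
  preimage of a cylinder negates one of its sides, and a fair coin is invariant under
  negation.\<close>

lemma distr_flip: "distr coin coin (flip n) = coin"
proof -
  interpret product_prob_space "\<lambda>_. measure_pmf (bernoulli_pmf (1/2))" "UNIV :: nat set"
    by unfold_locales
  show ?thesis
    unfolding coin_def
  proof (rule PiM_eq)
    fix J :: "nat set" and F :: "nat \<Rightarrow> bool set"
    assume J: "finite J" "J \<subseteq> UNIV"
      and F: "\<And>j. j \<in> J \<Longrightarrow> F j \<in> measure_pmf.events (bernoulli_pmf (1/2))"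
    define F' where "F' j = (if j = n then Not -` F j else F j)" for j
    have m: "measure_pmf (bernoulli_pmf (1/2)) (Not -` X) = measure_pmf (bernoulli_pmf (1/2)) X" for X
    proof -
      have "map_pmf Not (bernoulli_pmf (1/2)) = bernoulli_pmf (1/2)"
      proof (rule pmf_eqI)
        fix b
        have "Not -` {b} = {\<not> b}" by auto
        then show "pmf (map_pmf Not (bernoulli_pmf (1/2))) b = pmf (bernoulli_pmf (1/2)) b"
          by (cases b) (simp_all add: pmf_map measure_pmf_single)
      qed
      then show ?thesis by (metis emeasure_map_pmf)
    qed
    have "flip n -` prod_emb UNIV (\<lambda>_. measure_pmf (bernoulli_pmf (1/2))) J (Pi\<^sub>E J F)
        = prod_emb UNIV (\<lambda>_. measure_pmf (bernoulli_pmf (1/2))) J (Pi\<^sub>E J F')"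
      by (auto simp: prod_emb_def PiE_iff F'_def flip_def split: if_split_asm)
    then have "emeasure (distr coin coin (flip n)) (prod_emb UNIV (\<lambda>_. measure_pmf (bernoulli_pmf (1/2))) J (Pi\<^sub>E J F))
      = emeasure coin (prod_emb UNIV (\<lambda>_. measure_pmf (bernoulli_pmf (1/2))) J (Pi\<^sub>E J F'))"
      using J flip_measurable[of n]
      by (subst emeasure_distr) (auto simp: coin_def intro!: sets_PiM_I)
    also have "\<dots> = (\<Prod>j\<in>J. measure_pmf (bernoulli_pmf (1/2)) (F' j))"
      unfolding coin_def using J by (intro emeasure_PiM_emb) auto
    also have "\<dots> = (\<Prod>j\<in>J. measure_pmf (bernoulli_pmf (1/2)) (F j))"
      by (intro prod.cong) (auto simp: F'_def m)
    finally show "emeasure (distr (Pi\<^sub>M UNIV (\<lambda>_. measure_pmf (bernoulli_pmf (1/2)))) (Pi\<^sub>M UNIV (\<lambda>_. measure_pmf (bernoulli_pmf (1/2)))) (flip n)) (prod_emb UNIV (\<lambda>_. measure_pmf (bernoulli_pmf (1/2))) J (Pi\<^sub>E J F))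
      = (\<Prod>j\<in>J. measure_pmf (bernoulli_pmf (1/2)) (F j))"
      unfolding coin_def .
  qed simp
qed

text \<open>The product of the weights of levels \<open>m, \<dots>, n - 1\<close> is a supermartingale in \<open>n\<close>:
  flipping \<open>x(k)\<close> exchanges the two successors of \<open>x\<restriction>k\<close>, and in each case the two
  weights add up to at most \<open>2\<close>. It tends to infinity if \<open>x\<close> avoids \<open>B\<close> above level \<open>m\<close> while its
  comb meets \<open>B\<close> infinitely often.\<close>

definition weight :: "nat list set \<Rightarrow> nat \<Rightarrow> (nat \<Rightarrow> bool) \<Rightarrow> ennreal" where
  "weight B k x = (if path x (Suc k) \<in> B then 0 else if comb_node x k \<in> B then 2 else 1)"

lemma weight_measurable [measurable]: "weight B k \<in> borel_measurable coin"
  unfolding weight_def by measurable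

text \<open>Instead of conditional expectations, the integrand is added to its composition with
  \<open>flip n\<close>. The two have the same integral, and their sum is at most twice the product
  one level shorter.\<close>

lemma nn_integral_prod_weight:
  assumes "m \<le> n"
  shows "(\<integral>\<^sup>+x. (\<Prod>k\<in>{m..<n}. weight B k x) \<partial>coin) \<le> 1"
  using assms
proof (induction n rule: dec_induct)
  case base
  show ?case using prob_space.emeasure_space_1[OF prob_space_coin] by simp
next
  case (step n)
  define W where "W l x = (\<Prod>k\<in>{m..<l}. weight B k x)" for l x
  have [measurable]: "W l \<in> borel_measurable coin" for l unfolding W_def by measurable
  \<comment> \<open>Weights of levels below \<open>n\<close> depend only on coordinates below
    \<open>n\<close>.\<close>
  have Wn: "W n (flip n x) = W n x" for x
    unfolding W_def by (intro prod.cong) (auto simp: weight_def path_flip comb_node_flip)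
  have "W (Suc n) x + W (Suc n) (flip n x) \<le> 2 * W n x" for x
  proof -
    have "W (Suc n) x + W (Suc n) (flip n x) = W n x * (weight B n x + weight B n (flip n x))"
      using step(1) Wn[of x] by (simp add: W_def distrib_left)
    \<comment> \<open>The weights are 1 and 1 if neither successor is in \<open>B\<close>, 0 and 2
      if exactly one is, and 0 and 0 if both are.\<close>
    also have "\<dots> \<le> W n x * 2"
      by (intro mult_left_mono) (auto simp: weight_def path_Suc_flip comb_node_flip_same)
    finally show ?thesis by (simp add: mult.commute)
  qed
  then have "(\<integral>\<^sup>+x. W (Suc n) x + W (Suc n) (flip n x) \<partial>coin) \<le> (\<integral>\<^sup>+x. 2 * W n x \<partial>coin)"
    by (intro nn_integral_mono)
  also have "\<dots> = 2 * (\<integral>\<^sup>+x. W n x \<partial>coin)"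
    by (rule nn_integral_cmult) measurable
  also have "\<dots> \<le> 2 * 1"
    using step(3) unfolding W_def by (intro mult_left_mono) auto
  finally have le: "(\<integral>\<^sup>+x. W (Suc n) x + W (Suc n) (flip n x) \<partial>coin) \<le> 2" by simp
  have "(\<integral>\<^sup>+x. W (Suc n) (flip n x) \<partial>coin) = (\<integral>\<^sup>+x. W (Suc n) x \<partial>distr coin coin (flip n))"
    by (rule nn_integral_distr[symmetric]) measurable
  then have "(\<integral>\<^sup>+x. W (Suc n) (flip n x) \<partial>coin) = (\<integral>\<^sup>+x. W (Suc n) x \<partial>coin)"
    by (simp add: distr_flip)
  with le have "2 * (\<integral>\<^sup>+x. W (Suc n) x \<partial>coin) \<le> 2 * 1"
    by (simp add: nn_integral_add mult_2)
  then have "(\<integral>\<^sup>+x. W (Suc n) x \<partial>coin) \<le> 1"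
    by (subst (asm) ennreal_mult_le_mult_iff) auto
  then show ?case unfolding W_def .
qed

text \<open>By Fatou's lemma the products of weights have finite lower limit almost everywhere. Once
  the path of \<open>x\<close> has left \<open>B\<close>, the product is 2 to the number of comb
  nodes of \<open>x\<close> met in \<open>B\<close>, so this number stays bounded.\<close>

lemma AE_finite_comb:
  assumes "off_branch B"
  shows "AE x in coin. finite (comb x \<inter> B)"
proof -
  have ev: "\<exists>m. \<forall>k\<ge>m. path x k \<notin> B" for x
  proof -
    have "finite (B \<inter> range (path x))"
      using assms branch_path by (simp add: off_branch_def)
    then have "finite (path x -` (B \<inter> range (path x)))"
      by (rule finite_vimageI) (metis injI length_path)
    then obtain m where "path x -` (B \<inter> range (path x)) \<subseteq> {..<m}"
      by (rule finite_nat_bounded[THEN exE])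
    then show ?thesis by (intro exI[of _ m]) force
  qed
  have "AE x in coin. liminf (\<lambda>n. \<Prod>k\<in>{m..<n}. weight B k x) \<noteq> \<infinity>" for m
  proof (rule nn_integral_PInf_AE)
    have "(\<integral>\<^sup>+x. liminf (\<lambda>n. \<Prod>k\<in>{m..<n}. weight B k x) \<partial>coin)
      \<le> liminf (\<lambda>n. \<integral>\<^sup>+x. (\<Prod>k\<in>{m..<n}. weight B k x) \<partial>coin)"
      by (intro nn_integral_liminf borel_measurable_prod_ennreal weight_measurable)
    also have "\<dots> \<le> 1"
    proof (rule order_trans[OF Liminf_le_Limsup], simp)
      \<comment> \<open>The bound on the integrals is available from \<open>n = m\<close> on, which
        is enough for the upper limit.\<close>
      show "limsup (\<lambda>n. \<integral>\<^sup>+x. (\<Prod>k\<in>{m..<n}. weight B k x) \<partial>coin) \<le> 1"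
        by (intro Limsup_bounded eventually_sequentiallyI[of m] nn_integral_prod_weight)
    qed
    finally show "(\<integral>\<^sup>+x. liminf (\<lambda>n. \<Prod>k\<in>{m..<n}. weight B k x) \<partial>coin) \<noteq> \<infinity>"
      by (auto simp: top_unique)
  qed (intro borel_measurable_liminf borel_measurable_prod_ennreal weight_measurable)
  \<comment> \<open>The level at which the path leaves \<open>B\<close> depends on \<open>x\<close>,
    so all starting levels are treated on one set of full measure.\<close>
  then have "AE x in coin. \<forall>m. liminf (\<lambda>n. \<Prod>k\<in>{m..<n}. weight B k x) \<noteq> \<infinity>"
    by (simp add: AE_all_countable)
  then show ?thesis
  proof (rule AE_mp, intro AE_I2 impI)
    fix x assume fin: "\<forall>m. liminf (\<lambda>n. \<Prod>k\<in>{m..<n}. weight B k x) \<noteq> \<infinity>"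
    obtain m where m: "\<forall>k\<ge>m. path x k \<notin> B" using ev by blast
    show "finite (comb x \<inter> B)"
    proof (rule ccontr)
      assume "infinite (comb x \<inter> B)"
      moreover have "comb x \<inter> B = comb_node x ` {k. comb_node x k \<in> B}"
        by (auto simp: comb_def)
      ultimately have inf: "infinite {k. comb_node x k \<in> B}" by auto
      have prod: "(\<Prod>k\<in>{m..<n}. weight B k x) = 2 ^ card {k\<in>{m..<n}. comb_node x k \<in> B}" for n
      proof -
        have "(\<Prod>k\<in>{m..<n}. weight B k x) = (\<Prod>k\<in>{m..<n}. if comb_node x k \<in> B then 2 else 1)"
          using m by (intro prod.cong) (auto simp: weight_def)
        also have "\<dots> = (\<Prod>k\<in>{k\<in>{m..<n}. comb_node x k \<in> B}. 2)"
          by (rule prod.inter_filter[symmetric]) simp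
        finally show ?thesis by simp
      qed
      have large: "of_nat j \<le> liminf (\<lambda>n. \<Prod>k\<in>{m..<n}. weight B k x)" for j :: nat
      proof (rule Liminf_bounded)
        have "{k. comb_node x k \<in> B} \<subseteq> {..<m} \<union> {k. m \<le> k \<and> comb_node x k \<in> B}"
          by auto
        then have "infinite {k. m \<le> k \<and> comb_node x k \<in> B}"
          using inf finite_subset by fastforce
        then obtain S where S: "finite S" "card S = j" "S \<subseteq> {k. m \<le> k \<and> comb_node x k \<in> B}"
          using infinite_arbitrarily_large by blast
        obtain N where N: "S \<subseteq> {..<N}"
          by (rule finite_nat_bounded[OF S(1), THEN exE])
        have "of_nat j \<le> (\<Prod>k\<in>{m..<n}. weight B k x)" if "n \<ge> N" for n
        proof -
          have sub: "S \<subseteq> {k\<in>{m..<n}. comb_node x k \<in> B}"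
          proof
            fix k assume "k \<in> S"
            with S(3) N have "m \<le> k" "comb_node x k \<in> B" "k < N" by auto
            with that show "k \<in> {k\<in>{m..<n}. comb_node x k \<in> B}" by simp
          qed
          have "j \<le> card {k\<in>{m..<n}. comb_node x k \<in> B}"
            unfolding S(2)[symmetric] by (rule card_mono[OF _ sub]) simp
          also have "\<dots> \<le> 2 ^ card {k\<in>{m..<n}. comb_node x k \<in> B}"
            by (rule less_imp_le) (rule less_exp)
          finally have "(of_nat j :: ennreal) \<le> of_nat (2 ^ card {k\<in>{m..<n}. comb_node x k \<in> B})"
            by (simp only: of_nat_le_iff)
          also have "\<dots> = (\<Prod>k\<in>{m..<n}. weight B k x)"
            unfolding prod by simp
          finally show ?thesis .
        qed
        then show "\<forall>\<^sub>F n in sequentially. of_nat j \<le> (\<Prod>k\<in>{m..<n}. weight B k x)"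
          by (rule eventually_sequentiallyI)
      qed
      have "liminf (\<lambda>n. \<Prod>k\<in>{m..<n}. weight B k x) < top"
        using fin by (simp add: less_top)
      then obtain j where "liminf (\<lambda>n. \<Prod>k\<in>{m..<n}. weight B k x) < of_nat j"
        by (rule ennreal_Ex_less_of_nat[THEN exE])
      with large[of j] show False by (simp add: not_less[symmetric])
    qed
  qed
qed

section \<open>The random comb\<close>

lemma abs_le_iff:
  "E \<in> sets coin \<Longrightarrow> F \<in> sets coin \<Longrightarrow>
    abs_measure_algebra E \<le> abs_measure_algebra F \<longleftrightarrow> (AE x in coin. x \<in> E \<longrightarrow> x \<in> F)"
  by (simp add: less_eq_measure_algebra.abs_eq ae_eq_def null_diff_iff_AE)

lemma abs_eq_bot_iff:
  assumes "E \<in> sets coin"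
  shows "abs_measure_algebra E = bot \<longleftrightarrow> (AE x in coin. x \<notin> E)"
proof -
  have "abs_measure_algebra E = bot \<longleftrightarrow> abs_measure_algebra E \<le> abs_measure_algebra {}"
    by (simp add: bot_measure_algebra.abs_eq[symmetric] bot_unique)
  then show ?thesis using assms by (simp add: abs_le_iff)
qed

lemma inf_abs:
  "E \<in> sets coin \<Longrightarrow> F \<in> sets coin \<Longrightarrow>
    inf (abs_measure_algebra E) (abs_measure_algebra F) = abs_measure_algebra (E \<inter> F)"
  by (simp add: inf_measure_algebra.abs_eq ae_eq_def)

lemma measure_algebra_cases:
  obtains Q where "q = abs_measure_algebra Q" "Q \<in> sets coin"
proof -
  have "\<exists>Q. q = abs_measure_algebra Q \<and> Q \<in> sets coin"
    by (induct q rule: measure_algebra.abs_induct) (auto simp: ae_eq_def)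
  then show thesis using that by blast
qed

text \<open>If \<open>q\<close> met every \<open>E i\<close> in a null set, it would meet their
  union in a null set, although that union has full measure. Hence below any condition one of
  countably many alternatives can be decided.\<close>

lemma countable_decision:
  assumes "countable I" "\<And>i. i \<in> I \<Longrightarrow> E i \<in> sets coin" "AE x in coin. \<exists>i\<in>I. x \<in> E i" "q \<noteq> bot"
  shows "\<exists>i\<in>I. inf q (abs_measure_algebra (E i)) \<noteq> bot"
proof (rule ccontr)
  obtain Q where Q: "q = abs_measure_algebra Q" "Q \<in> sets coin" by (rule measure_algebra_cases)
  assume "\<not> (\<exists>i\<in>I. inf q (abs_measure_algebra (E i)) \<noteq> bot)"
  then have "\<forall>i\<in>I. AE x in coin. x \<notin> Q \<inter> E i"
    using assms(2) Q by (simp add: inf_abs abs_eq_bot_iff)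
  then have "AE x in coin. \<forall>i\<in>I. x \<notin> Q \<inter> E i"
    by (subst AE_ball_countable[OF assms(1)])
  with assms(3) have "AE x in coin. x \<notin> Q" by eventually_elim blast
  then have "q = bot" using Q by (simp add: abs_eq_bot_iff)
  with assms(4) show False by simp
qed

lemma pred_comb [measurable]: "Measurable.pred coin (\<lambda>x. s \<in> comb x)"
proof -
  have "Measurable.pred coin (\<lambda>x. \<exists>n. comb_node x n \<in> {s})" by measurable
  moreover have "(\<exists>n. comb_node x n \<in> {s}) \<longleftrightarrow> s \<in> comb x" for x by (auto simp: comb_def)
  ultimately show ?thesis by (simp only:)
qed

definition comb_value :: "nat list \<Rightarrow> measure_algebra" where
  "comb_value s = abs_measure_algebra {x. s \<in> comb x}"

lemma comb_sets [measurable]: "{x. s \<in> comb x} \<in> sets coin"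
  using pred_comb[of s] by (simp add: pred_def)

lemma comb_value_antichain:
  assumes "prefix s t" "s \<noteq> t" shows "inf (comb_value s) (comb_value t) = bot"
  using assms comb_antichain by (auto simp: comb_value_def inf_abs abs_eq_bot_iff)

text \<open>Every comb is infinite, so it includes one of the countably many sets of
  \<open>k\<close> nodes; some such set can be decided below \<open>q\<close>.\<close>

lemma comb_value_infinite:
  assumes "q \<noteq> bot"
  shows "\<exists>r C. r \<noteq> bot \<and> r \<le> q \<and> finite C \<and> card C = k \<and> (\<forall>s\<in>C. r \<le> comb_value s)"
proof -
  define E where "E C = {x. C \<subseteq> comb x}" for C :: "nat list set"
  have sets: "E C \<in> sets coin" if "finite C" for C
  proof -
    have "Measurable.pred coin (\<lambda>x. \<forall>s\<in>C. s \<in> comb x)"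
      using that by measurable
    then show ?thesis by (simp add: E_def subset_eq pred_def)
  qed
  have "\<exists>C\<in>{C. finite C \<and> card C = k}. inf q (abs_measure_algebra (E C)) \<noteq> bot"
  proof (rule countable_decision)
    show "countable {C :: nat list set. finite C \<and> card C = k}"
      by (rule countable_subset[OF _ countable_Collect_finite]) auto
    have "\<exists>C\<in>{C. finite C \<and> card C = k}. x \<in> E C" for x
      using infinite_arbitrarily_large[OF infinite_comb[of x], of k] by (auto simp: E_def)
    then show "AE x in coin. \<exists>C\<in>{C. finite C \<and> card C = k}. x \<in> E C" by simp
  qed (use sets assms in auto)
  then obtain C where C: "finite C" "card C = k" "inf q (abs_measure_algebra (E C)) \<noteq> bot" by blast
  have "abs_measure_algebra (E C) \<le> comb_value s" if "s \<in> C" for s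
    unfolding comb_value_def using that sets[OF C(1)] by (subst abs_le_iff) (auto simp: E_def)
  then have "\<forall>s\<in>C. inf q (abs_measure_algebra (E C)) \<le> comb_value s" by (blast intro: le_infI2)
  with C show ?thesis by (intro exI[of _ "inf q (abs_measure_algebra (E C))"] exI[of _ C]) simp
qed

text \<open>Almost surely the intersection with \<open>B\<close> is one of the countably many finite
  sets of nodes. The condition \<open>r\<close> is \<open>q\<close> restricted to one possible value
  \<open>C\<close> of it.\<close>

lemma comb_value_almost_disjoint:
  assumes "off_branch B" "q \<noteq> bot"
  shows "\<exists>r C. r \<noteq> bot \<and> r \<le> q \<and> finite C \<and> C \<subseteq> B \<and>
    (\<forall>s\<in>C. r \<le> comb_value s) \<and> (\<forall>s\<in>B - C. inf r (comb_value s) = bot)"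
proof -
  define E where "E C = {x. comb x \<inter> B = C}" for C
  have sets: "E C \<in> sets coin" for C
  proof -
    have "Measurable.pred coin (\<lambda>x. \<forall>s. s \<in> comb x \<and> s \<in> B \<longleftrightarrow> s \<in> C)"
      by measurable
    moreover have "comb x \<inter> B = C \<longleftrightarrow> (\<forall>s. s \<in> comb x \<and> s \<in> B \<longleftrightarrow> s \<in> C)" for x by blast
    ultimately show ?thesis by (simp add: E_def pred_def)
  qed
  have "\<exists>C\<in>{C. finite C}. inf q (abs_measure_algebra (E C)) \<noteq> bot"
  proof (rule countable_decision)
    show "AE x in coin. \<exists>C\<in>{C. finite C}. x \<in> E C"
      using AE_finite_comb[OF assms(1)] by eventually_elim (simp add: E_def)
  qed (use sets assms countable_Collect_finite in auto)
  then obtain C where C: "finite C" "inf q (abs_measure_algebra (E C)) \<noteq> bot" by blast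
  have le: "abs_measure_algebra (E C) \<le> comb_value s" if "s \<in> C" for s
    unfolding comb_value_def using that sets by (subst abs_le_iff) (auto simp: E_def)
  have disj: "inf (abs_measure_algebra (E C)) (comb_value s) = bot" if "s \<in> B - C" for s
    unfolding comb_value_def using that sets by (auto simp: inf_abs abs_eq_bot_iff E_def)
  \<comment> \<open>Otherwise no \<open>x\<close> has this intersection and the chosen condition
    would be zero.\<close>
  have "C \<subseteq> B"
  proof (rule ccontr)
    assume "\<not> C \<subseteq> B"
    then have "E C = {}" by (auto simp: E_def)
    then show False using C(2) by (simp add: bot_measure_algebra.abs_eq[symmetric])
  qed
  moreover have "\<forall>s\<in>C. inf q (abs_measure_algebra (E C)) \<le> comb_value s"
    using le by (blast intro: le_infI2)
  moreover have "\<forall>s\<in>B - C. inf (inf q (abs_measure_algebra (E C))) (comb_value s) = bot"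
    using disj by (simp add: inf_assoc)
  ultimately show ?thesis
    using C by (intro exI[of _ "inf q (abs_measure_algebra (E C))"] exI[of _ C]) simp
qed

theorem theorem6p3:
  fixes \<O> :: "nat list set set"
  assumes large_universe: "\<exists>h :: 'i \<Rightarrow> nat list set. surj h"
    and family: "off_branch_family \<O>"
  shows "holds_in_extension (Neg (fm_maximal (family_name \<O> :: ('i, measure_algebra) name)))"
proof -
  obtain h :: "'i \<Rightarrow> nat list set" where h: "surj h" using large_universe by blast
  have infinite: "infinite (UNIV :: 'i set)"
  proof
    assume "finite (UNIV :: 'i set)"
    then have "finite (range h)" by (rule finite_imageI)
    then have "finite (Pow (UNIV :: nat list set))" using h by simp
    then show False by (metis finite_Pow_iff infinite_UNIV_listI)
  qed
  \<comment> \<open>Turns the indexing of all sets of nodes into one of all nodes, by way of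
    singletons.\<close>
  obtain g :: "nat list set \<Rightarrow> nat list" where g: "surj g"
    using surjI[of the_elem "\<lambda>s. {s}"] by auto
  \<comment> \<open>The name of the generic comb. Nodes repeated in the indexing only repeat the
    same pair.\<close>
  define A :: "('i, measure_algebra) name"
    where "A = Name (\<lambda>i. Some (node_name (g (h i)), comb_value (g (h i))))"
  have "elems A = (\<lambda>s. (node_name s, comb_value s)) ` range (\<lambda>i. g (h i))"
    by (auto simp: A_def ran_def)
  also have "range (\<lambda>i. g (h i)) = UNIV"
    using comp_surj[OF h g] by (simp add: comp_def)
  finally have A: "elems A = range (\<lambda>s. (node_name s, comb_value s))" .
  \<comment> \<open>Here the index type must be as large as the continuum: it indexes every set of
    nodes, hence every member of the family.\<close>
  have "node_set_name ` \<O> \<subseteq> range (\<lambda>i. node_set_name (h i) :: ('i, measure_algebra) name)"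
    using h by (metis image_mono range_composition top_greatest)
  then have F: "elems (family_name \<O> :: ('i, measure_algebra) name) = (\<lambda>x. (x, top)) ` node_set_name ` \<O>"
    unfolding family_name_def by (rule elems_hat)
  show ?thesis
    using infinite A F comb_value_antichain comb_value_infinite
  proof (rule not_maximal_if)
    fix B and q :: measure_algebra assume "B \<in> \<O>" "q \<noteq> bot"
    then show "\<exists>r C. r \<noteq> bot \<and> r \<le> q \<and> finite C \<and> C \<subseteq> B \<and>
        (\<forall>s\<in>C. r \<le> comb_value s) \<and> (\<forall>s\<in>B - C. inf r (comb_value s) = bot)"
      using family by (intro comb_value_almost_disjoint) (auto simp: off_branch_family_def)
  qed
qed

end
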